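(* Let $A=(a_{ij})_{i,j\in I}$ be a generalized Cartan matrix such that $\Gamma(A)$ is a conical tree with the root $0$ and $a_{ij}\in\{0,-1\}$ for all distinct $i,j\in I$ with $j\ne0$. Let $\mathfrak g=\mathfrak g_A$, $\mathbf a=(a_i)_{i\in I}\in\mathbb C^I$, and $u_i=e_i+a_i[e_i,f_i]-a_i^2f_i$. Put $\mathbf f:=\sum_{j\in I:\,j^+=0}a_jf_j$ and $g_{\mathbf a}=e^{a_0f_0}\prod_{i\neq0}e^{a_if_i}$, where the product is decreasing (i.e. $i^+$ always precedes $i$). Then for $i\in I$ $$(\mathrm{Ad}\,g_{\mathbf a})(u_i)=\begin{cases}e_i+b_{i^-}f_{i^-}&\text{if }i\neq0\\[2pt] e_0-a_0\mathbf f-\dfrac{a_0^2}{2}[\mathbf f,[\mathbf f,f_0]]-\displaystyle\sum_{k\ge3}\frac{a_0^2}{k!}\big(\mathrm{ad}(\mathbf f+a_0[f_0,\mathbf f])\big)^{k-2}\big([\mathbf f,[\mathbf f,f_0]]\big)&\text{if }i=0\end{cases}$$ where $b_{i^-}:=-a_{i^-}a_i$ for $i\neq 0$ not a leaf, with the convention that the term $b_{i^-}f_{i^-}$ is $0$ for any leaf $i$.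
   Context: A generalized Cartan matrix has $a_{ii}=2$, $a_{ij}\in\mathbb Z_{\le0}$ for $i\ne j$, $a_{ij}=0$ iff $a_{ji}=0$. $\mathfrak g_A$ is the complex Lie algebra generated by $e_i,f_i$, $h_i:=[e_i,f_i]$, subject to $[h_i,h_j]=0$, $[e_i,f_j]=\delta_{ij}h_i$, $[h_i,e_j]=a_{ij}e_j$, $[h_i,f_j]=-a_{ij}f_j$, and the Serre relations $(\mathrm{ad}\,e_i)^{1-a_{ij}}(e_j)=(\mathrm{ad}\,f_i)^{1-a_{ij}}(f_j)=0$. $\Gamma(A)$ is the graph on vertex set $I$ in which $\{i,j\}$, $i\neq j$, is an edge iff $a_{ij}<0$. A rooted tree (root denoted $0$) is conical if the only possible branching is at the root. For $i\ne0$, $i^+$ is the parent of $i$; for a non-leaf $i\neq0$, $i^-$ is the unique child of $i$. $\mathrm{Ad}\,e^{x}$ means the automorphism $e^{\mathrm{ad}\,x}=\sum_k\frac1{k!}(\mathrm{ad}\,x)^k$ of $\mathfrak g$ (for locally ad-nilpotent $x$), and $\mathrm{Ad}$ of a product is the composition. Double-index $a_{ij}$ are Cartan entries; single-index $a_i$ are parameters. *)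

theory Defs
  imports Complex_Main "HOL-Algebra.Module"
begin

section \<open>Complex Lie algebras\<close>

definition complex_ring :: "complex ring" where
  "complex_ring = \<lparr>carrier = UNIV, mult = (*), one = 1, zero = 0, add = (+)\<rparr>"

text \<open>
  As for every module record of HOL-Algebra, the inherited fields \<^term>\<open>mult\<close> and \<^term>\<open>one\<close> carry no
  meaning; the Lie bracket is the new field.
\<close>

record 'a lie_alg = "(complex, 'a) module" +
  lie_bracket :: "'a \<Rightarrow> 'a \<Rightarrow> 'a" (\<open>br\<index>\<close>)

locale complex_lie_algebra = module complex_ring L for L (structure) +
  assumes br_closed: "\<lbrakk>x \<in> carrier L; y \<in> carrier L\<rbrakk> \<Longrightarrow> br x y \<in> carrier L"
    and br_add_left: "\<lbrakk>x \<in> carrier L; y \<in> carrier L; z \<in> carrier L\<rbrakk>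
      \<Longrightarrow> br (x \<oplus> y) z = br x z \<oplus> br y z"
    and br_add_right: "\<lbrakk>x \<in> carrier L; y \<in> carrier L; z \<in> carrier L\<rbrakk>
      \<Longrightarrow> br x (y \<oplus> z) = br x y \<oplus> br x z"
    and br_smult_left: "\<lbrakk>x \<in> carrier L; y \<in> carrier L\<rbrakk> \<Longrightarrow> br (c \<odot> x) y = c \<odot> br x y"
    and br_smult_right: "\<lbrakk>x \<in> carrier L; y \<in> carrier L\<rbrakk> \<Longrightarrow> br x (c \<odot> y) = c \<odot> br x y"
    and br_self: "x \<in> carrier L \<Longrightarrow> br x x = \<zero>"
    and br_jacobi: "\<lbrakk>x \<in> carrier L; y \<in> carrier L; z \<in> carrier L\<rbrakk>
      \<Longrightarrow> br x (br y z) \<oplus> br y (br z x) \<oplus> br z (br x y) = \<zero>"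

text \<open>
  The sum of a family with finite support, i.e. with \<^term>\<open>t k \<noteq> zero L\<close> for only finitely many
  \<open>k \<in> K\<close>.  For a family with infinite support the value is the default value of
  \<^term>\<open>finsum\<close>.
\<close>

definition supp_sum :: "('a, 'm) lie_alg_scheme \<Rightarrow> (nat \<Rightarrow> 'a) \<Rightarrow> nat set \<Rightarrow> 'a" where
  "supp_sum L t K = finsum L t {k \<in> K. t k \<noteq> \<zero>\<^bsub>L\<^esub>}"

text \<open>
  \<open>exp_ad L x\<close> is \<open>Ad e\<^sup>x\<close>, for locally ad-nilpotent \<open>x\<close>;
  \<open>Ad_prod L [x\<^sub>1, \<dots>, x\<^sub>n]\<close> is \<open>Ad (e\<^bsup>x1\<^esup> \<dots> e\<^bsup>xn\<^esup>)\<close>, so the last factor acts first.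
\<close>

definition exp_ad :: "('a, 'm) lie_alg_scheme \<Rightarrow> 'a \<Rightarrow> 'a \<Rightarrow> 'a" where
  "exp_ad L x y = supp_sum L (\<lambda>k. (1 / fact k) \<odot>\<^bsub>L\<^esub> ((br\<^bsub>L\<^esub> x ^^ k) y)) UNIV"

definition Ad_prod :: "('a, 'm) lie_alg_scheme \<Rightarrow> 'a list \<Rightarrow> 'a \<Rightarrow> 'a" where
  "Ad_prod L xs = foldr (exp_ad L) xs"


section \<open>Lie algebras given by generators and relations\<close>

datatype 'g lie_term =
    Gen 'g
  | LZero
  | LAdd "'g lie_term" "'g lie_term"
  | LScale complex "'g lie_term"
  | LBr "'g lie_term" "'g lie_term"

text \<open>
  The least congruence on Lie terms which contains the given relations and all instances of the
  axioms of a complex Lie algebra.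
\<close>

inductive lie_cong :: "('g lie_term \<Rightarrow> 'g lie_term \<Rightarrow> bool) \<Rightarrow> 'g lie_term \<Rightarrow> 'g lie_term \<Rightarrow> bool"
  for R where
  rel: "R s t \<Longrightarrow> lie_cong R s t"
| refl: "lie_cong R t t"
| sym: "lie_cong R s t \<Longrightarrow> lie_cong R t s"
| trans: "\<lbrakk>lie_cong R s t; lie_cong R t u\<rbrakk> \<Longrightarrow> lie_cong R s u"
| cong_add: "\<lbrakk>lie_cong R s s'; lie_cong R t t'\<rbrakk> \<Longrightarrow> lie_cong R (LAdd s t) (LAdd s' t')"
| cong_scale: "lie_cong R t t' \<Longrightarrow> lie_cong R (LScale c t) (LScale c t')"
| cong_br: "\<lbrakk>lie_cong R s s'; lie_cong R t t'\<rbrakk> \<Longrightarrow> lie_cong R (LBr s t) (LBr s' t')"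
| add_assoc: "lie_cong R (LAdd (LAdd s t) u) (LAdd s (LAdd t u))"
| add_comm: "lie_cong R (LAdd s t) (LAdd t s)"
| add_zero: "lie_cong R (LAdd LZero t) t"
| add_neg: "lie_cong R (LAdd (LScale (-1) t) t) LZero"
| scale_add: "lie_cong R (LScale c (LAdd s t)) (LAdd (LScale c s) (LScale c t))"
| add_scale: "lie_cong R (LScale (c + d) t) (LAdd (LScale c t) (LScale d t))"
| scale_scale: "lie_cong R (LScale (c * d) t) (LScale c (LScale d t))"
| scale_one: "lie_cong R (LScale 1 t) t"
| br_add_left: "lie_cong R (LBr (LAdd s t) u) (LAdd (LBr s u) (LBr t u))"
| br_add_right: "lie_cong R (LBr s (LAdd t u)) (LAdd (LBr s t) (LBr s u))"
| br_scale_left: "lie_cong R (LBr (LScale c s) t) (LScale c (LBr s t))"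
| br_scale_right: "lie_cong R (LBr s (LScale c t)) (LScale c (LBr s t))"
| br_self: "lie_cong R (LBr t t) LZero"
| jacobi: "lie_cong R (LAdd (LAdd (LBr s (LBr t u)) (LBr t (LBr u s))) (LBr u (LBr s t))) LZero"

definition lie_class :: "('g lie_term \<Rightarrow> 'g lie_term \<Rightarrow> bool) \<Rightarrow> 'g lie_term \<Rightarrow> 'g lie_term set" where
  "lie_class R t = {s. lie_cong R t s}"

definition lie_pres :: "('g lie_term \<Rightarrow> 'g lie_term \<Rightarrow> bool) \<Rightarrow> 'g lie_term set lie_alg" where
  "lie_pres R =
    \<lparr>carrier = range (lie_class R),
     mult = undefined,
     one = undefined,
     zero = lie_class R LZero,
     add = (\<lambda>X Y. \<Union>x\<in>X. \<Union>y\<in>Y. lie_class R (LAdd x y)),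
     smult = (\<lambda>c X. \<Union>x\<in>X. lie_class R (LScale c x)),
     lie_bracket = (\<lambda>X Y. \<Union>x\<in>X. \<Union>y\<in>Y. lie_class R (LBr x y))\<rparr>"

lemmas lie_cong_axioms =
  lie_cong.add_assoc lie_cong.add_comm lie_cong.add_zero lie_cong.scale_add lie_cong.add_scale
  lie_cong.scale_scale lie_cong.scale_one lie_cong.br_add_left lie_cong.br_add_right
  lie_cong.br_scale_left lie_cong.br_scale_right lie_cong.br_self lie_cong.jacobi

lemma lie_class_eq_iff: "lie_class R s = lie_class R t \<longleftrightarrow> lie_cong R s t"
proof
  assume "lie_class R s = lie_class R t"
  then have "t \<in> lie_class R s"
    by (simp add: lie_class_def lie_cong.refl)
  then show "lie_cong R s t"
    by (simp add: lie_class_def)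
next
  assume "lie_cong R s t"
  then have "lie_cong R s x \<longleftrightarrow> lie_cong R t x" for x
    by (meson lie_cong.sym lie_cong.trans)
  then show "lie_class R s = lie_class R t"
    by (simp add: lie_class_def)
qed

lemma lie_pres_simps:
  "carrier (lie_pres R) = range (lie_class R)"
  "\<zero>\<^bsub>lie_pres R\<^esub> = lie_class R LZero"
  "lie_class R s \<oplus>\<^bsub>lie_pres R\<^esub> lie_class R t = lie_class R (LAdd s t)"
  "c \<odot>\<^bsub>lie_pres R\<^esub> lie_class R t = lie_class R (LScale c t)"
  "br\<^bsub>lie_pres R\<^esub> (lie_class R s) (lie_class R t) = lie_class R (LBr s t)"
proof -
  have const: "(\<Union>x\<in>lie_class R t. lie_class R (f x)) = lie_class R (f t)"
    if "\<And>x. lie_cong R t x \<Longrightarrow> lie_cong R (f x) (f t)" for t and f :: "'a lie_term \<Rightarrow> 'a lie_term"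
  proof (rule UN_constant_eq)
    show "t \<in> lie_class R t"
      by (simp add: lie_class_def lie_cong.refl)
    show "\<forall>x\<in>lie_class R t. lie_class R (f x) = lie_class R (f t)"
      unfolding lie_class_eq_iff using that by (simp add: lie_class_def)
  qed
  have const2: "(\<Union>x\<in>lie_class R s. \<Union>y\<in>lie_class R t. lie_class R (f x y)) = lie_class R (f s t)"
    if f: "\<And>x x' y y'. lie_cong R x x' \<Longrightarrow> lie_cong R y y' \<Longrightarrow> lie_cong R (f x y) (f x' y')"
    for f :: "'a lie_term \<Rightarrow> 'a lie_term \<Rightarrow> 'a lie_term"
  proof -
    have "(\<Union>y\<in>lie_class R t. lie_class R (f x y)) = lie_class R (f x t)" for x
      by (rule const, rule f, rule lie_cong.refl, erule lie_cong.sym)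
    moreover have "(\<Union>x\<in>lie_class R s. lie_class R (f x t)) = lie_class R (f s t)"
      by (rule const, rule f, erule lie_cong.sym, rule lie_cong.refl)
    ultimately show ?thesis
      by (simp only:)
  qed
  show "carrier (lie_pres R) = range (lie_class R)" "\<zero>\<^bsub>lie_pres R\<^esub> = lie_class R LZero"
    by (simp_all add: lie_pres_def)
  show "lie_class R s \<oplus>\<^bsub>lie_pres R\<^esub> lie_class R t = lie_class R (LAdd s t)"
    using const2[of LAdd, OF lie_cong.cong_add] by (simp add: lie_pres_def)
  show "br\<^bsub>lie_pres R\<^esub> (lie_class R s) (lie_class R t) = lie_class R (LBr s t)"
    using const2[of LBr, OF lie_cong.cong_br] by (simp add: lie_pres_def)
  show "c \<odot>\<^bsub>lie_pres R\<^esub> lie_class R t = lie_class R (LScale c t)"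
    using const[of t "LScale c", OF lie_cong.cong_scale, OF lie_cong.sym] by (simp add: lie_pres_def)
qed

lemma cring_complex_ring: "cring complex_ring"
proof (rule cringI)
  show "abelian_group complex_ring"
    by (rule abelian_groupI) (auto simp: complex_ring_def algebra_simps intro: exI[of _ "- _"])
  show "comm_monoid complex_ring"
    by (rule comm_monoidI) (auto simp: complex_ring_def algebra_simps)
qed (auto simp: complex_ring_def algebra_simps)

lemma lie_pres_complex_lie_algebra: "complex_lie_algebra (lie_pres R)"
proof -
  have ab: "abelian_group (lie_pres R)"
  proof (rule abelian_groupI)
    fix x assume "x \<in> carrier (lie_pres R)"
    then obtain t where "x = lie_class R t"
      by (auto simp: lie_pres_simps)
    then show "\<exists>y\<in>carrier (lie_pres R). y \<oplus>\<^bsub>lie_pres R\<^esub> x = \<zero>\<^bsub>lie_pres R\<^esub>"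
      by (intro bexI[of _ "lie_class R (LScale (-1) t)"])
        (auto simp: lie_pres_simps lie_class_eq_iff lie_cong.add_neg)
  qed (clarsimp simp: lie_pres_simps lie_class_eq_iff rangeI intro!: lie_cong_axioms)+
  have "module complex_ring (lie_pres R)"
    by (rule moduleI[OF cring_complex_ring ab])
      (clarsimp simp: lie_pres_simps lie_class_eq_iff rangeI complex_ring_def intro!: lie_cong_axioms)+
  then show ?thesis
    by (intro complex_lie_algebra.intro complex_lie_algebra_axioms.intro)
      (clarsimp simp: lie_pres_simps lie_class_eq_iff rangeI complex_ring_def intro!: lie_cong_axioms)+
qed

text \<open>
  The universal property of the presentation: a family of elements of a complex Lie algebra that
  satisfies the relations also satisfies all consequences recorded by \<^const>\<open>lie_cong\<close>, so
  evaluation of terms factors through \<^const>\<open>lie_pres\<close>.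
\<close>

primrec lie_eval :: "('a, 'm) lie_alg_scheme \<Rightarrow> ('g \<Rightarrow> 'a) \<Rightarrow> 'g lie_term \<Rightarrow> 'a" where
  "lie_eval L \<phi> (Gen g) = \<phi> g"
| "lie_eval L \<phi> LZero = \<zero>\<^bsub>L\<^esub>"
| "lie_eval L \<phi> (LAdd s t) = lie_eval L \<phi> s \<oplus>\<^bsub>L\<^esub> lie_eval L \<phi> t"
| "lie_eval L \<phi> (LScale c t) = c \<odot>\<^bsub>L\<^esub> lie_eval L \<phi> t"
| "lie_eval L \<phi> (LBr s t) = br\<^bsub>L\<^esub> (lie_eval L \<phi> s) (lie_eval L \<phi> t)"

lemma (in complex_lie_algebra) lie_eval_closed:
  "range \<phi> \<subseteq> carrier L \<Longrightarrow> lie_eval L \<phi> t \<in> carrier L"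
proof (induction t)
  case (LScale c t)
  then show ?case
    using smult_closed[of c "lie_eval L \<phi> t"] by (simp add: complex_ring_def)
qed (auto intro: br_closed)

lemma (in complex_lie_algebra) lie_eval_cong:
  assumes gen: "range \<phi> \<subseteq> carrier L"
    and rels: "\<And>s t. R s t \<Longrightarrow> lie_eval L \<phi> s = lie_eval L \<phi> t"
    and "lie_cong R s t"
  shows "lie_eval L \<phi> s = lie_eval L \<phi> t"
  using assms(3)
proof (induction rule: lie_cong.induct)
  case (add_neg t)
  have m: "(-1) \<odot> lie_eval L \<phi> t = \<ominus> lie_eval L \<phi> t"
  proof -
    have "\<ominus>\<^bsub>complex_ring\<^esub> \<one>\<^bsub>complex_ring\<^esub> = - 1"
      by (rule R.minus_equality) (auto simp: complex_ring_def)
    then show ?thesis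
      using smult_l_minus[of "\<one>\<^bsub>complex_ring\<^esub>" "lie_eval L \<phi> t"] lie_eval_closed[OF gen]
      by (simp add: smult_one)
  qed
  then show ?case
    using lie_eval_closed[OF gen, of t] by (simp add: l_neg)
next
  case (scale_add c s t)
  then show ?case
    using smult_r_distr[of c] lie_eval_closed[OF gen] by (simp add: complex_ring_def)
next
  case (add_scale c d t)
  then show ?case
    using smult_l_distr[of c d] lie_eval_closed[OF gen] by (simp add: complex_ring_def)
next
  case (scale_scale c d t)
  then show ?case
    using smult_assoc1[of c d] lie_eval_closed[OF gen] by (simp add: complex_ring_def)
next
  case (scale_one t)
  then show ?case
    using smult_one lie_eval_closed[OF gen] by (simp add: complex_ring_def)
next
  case (add_assoc s t u)
  then show ?case
    using lie_eval_closed[OF gen] by (simp add: a_assoc)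
next
  case (add_comm s t)
  then show ?case
    using lie_eval_closed[OF gen] by (simp add: a_comm)
next
  case (rel s t)
  then show ?case
    by (rule rels)
qed (simp_all add: lie_eval_closed[OF gen] br_add_left br_add_right br_smult_left
      br_smult_right br_self br_jacobi)


section \<open>The Lie algebra of a generalized Cartan matrix\<close>

definition gen_cartan_matrix :: "('i \<Rightarrow> 'i \<Rightarrow> int) \<Rightarrow> bool" where
  "gen_cartan_matrix A \<longleftrightarrow>
    (\<forall>i. A i i = 2) \<and>
    (\<forall>i j. i \<noteq> j \<longrightarrow> A i j \<le> 0) \<and>
    (\<forall>i j. A i j = 0 \<longleftrightarrow> A j i = 0)"

datatype 'i chevalley = GE 'i | GF 'i

abbreviation E_term :: "'i \<Rightarrow> 'i chevalley lie_term" where "E_term i \<equiv> Gen (GE i)"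
abbreviation F_term :: "'i \<Rightarrow> 'i chevalley lie_term" where "F_term i \<equiv> Gen (GF i)"
abbreviation H_term :: "'i \<Rightarrow> 'i chevalley lie_term" where "H_term i \<equiv> LBr (E_term i) (F_term i)"

text \<open>The Serre relations are imposed for \<open>i \<noteq> j\<close>, so \<open>1 - A i j\<close> is positive under \<^const>\<open>nat\<close>.\<close>

inductive cartan_rel ::
  "('i \<Rightarrow> 'i \<Rightarrow> int) \<Rightarrow> 'i chevalley lie_term \<Rightarrow> 'i chevalley lie_term \<Rightarrow> bool"
  for A where
  "cartan_rel A (LBr (H_term i) (H_term j)) LZero"
| "cartan_rel A (LBr (E_term i) (F_term j)) (if i = j then H_term i else LZero)"
| "cartan_rel A (LBr (H_term i) (E_term j)) (LScale (of_int (A i j)) (E_term j))"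
| "cartan_rel A (LBr (H_term i) (F_term j)) (LScale (- of_int (A i j)) (F_term j))"
| "i \<noteq> j \<Longrightarrow> cartan_rel A ((LBr (E_term i) ^^ nat (1 - A i j)) (E_term j)) LZero"
| "i \<noteq> j \<Longrightarrow> cartan_rel A ((LBr (F_term i) ^^ nat (1 - A i j)) (F_term j)) LZero"

definition kac_moody :: "('i \<Rightarrow> 'i \<Rightarrow> int) \<Rightarrow> 'i chevalley lie_term set lie_alg" where
  "kac_moody A = lie_pres (cartan_rel A)"

definition km_e :: "('i \<Rightarrow> 'i \<Rightarrow> int) \<Rightarrow> 'i \<Rightarrow> 'i chevalley lie_term set" where
  "km_e A i = lie_class (cartan_rel A) (E_term i)"

definition km_f :: "('i \<Rightarrow> 'i \<Rightarrow> int) \<Rightarrow> 'i \<Rightarrow> 'i chevalley lie_term set" where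
  "km_f A i = lie_class (cartan_rel A) (F_term i)"


section \<open>Conical trees\<close>

definition gamma_edge :: "('i \<Rightarrow> 'i \<Rightarrow> int) \<Rightarrow> 'i \<Rightarrow> 'i \<Rightarrow> bool" where
  "gamma_edge A i j \<longleftrightarrow> i \<noteq> j \<and> A i j < 0"

text \<open>
  Simple undirected graphs on the whole type \<open>'i\<close> are given by a symmetric irreflexive relation.
  In the tree notion for digraphs from the AFP entry Graph-Theory, a pair of opposite arcs is a
  cycle, so it does not apply to undirected graphs.
\<close>

definition graph_path :: "('i \<Rightarrow> 'i \<Rightarrow> bool) \<Rightarrow> 'i list \<Rightarrow> bool" where
  "graph_path G p \<longleftrightarrow> p \<noteq> [] \<and> distinct p \<and> successively G p"

definition graph_cycle :: "('i \<Rightarrow> 'i \<Rightarrow> bool) \<Rightarrow> 'i list \<Rightarrow> bool" where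
  "graph_cycle G p \<longleftrightarrow> graph_path G p \<and> length p \<ge> 3 \<and> G (last p) (hd p)"

definition graph_tree :: "('i \<Rightarrow> 'i \<Rightarrow> bool) \<Rightarrow> bool" where
  "graph_tree G \<longleftrightarrow>
    (\<forall>i j. \<exists>p. graph_path G p \<and> hd p = i \<and> last p = j) \<and>
    (\<nexists>p. graph_cycle G p)"

definition parent :: "('i \<Rightarrow> 'i \<Rightarrow> bool) \<Rightarrow> 'i \<Rightarrow> 'i \<Rightarrow> 'i" where
  "parent G r i = (THE j. \<exists>p. graph_path G (i # j # p) \<and> last (j # p) = r)"

definition children :: "('i \<Rightarrow> 'i \<Rightarrow> bool) \<Rightarrow> 'i \<Rightarrow> 'i \<Rightarrow> 'i set" where
  "children G r i = {j. j \<noteq> r \<and> parent G r j = i}"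

definition conical_tree :: "('i \<Rightarrow> 'i \<Rightarrow> bool) \<Rightarrow> 'i \<Rightarrow> bool" where
  "conical_tree G r \<longleftrightarrow> graph_tree G \<and> (\<forall>i. i \<noteq> r \<longrightarrow> card (children G r i) \<le> 1)"

definition only_child :: "('i \<Rightarrow> 'i \<Rightarrow> bool) \<Rightarrow> 'i \<Rightarrow> 'i \<Rightarrow> 'i" where
  "only_child G r i = (THE j. j \<in> children G r i)"

text \<open>An enumeration of the non-root vertices in which each vertex comes after its parent.\<close>

definition decreasing_enum :: "('i \<Rightarrow> 'i \<Rightarrow> bool) \<Rightarrow> 'i \<Rightarrow> 'i list \<Rightarrow> bool" where
  "decreasing_enum G r js \<longleftrightarrow>
    distinct js \<and> set js = UNIV - {r} \<and>
    (\<forall>m < length js. \<forall>n < length js. js ! m = parent G r (js ! n) \<longrightarrow> m < n)"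


section \<open>The elements in the theorem\<close>

definition u_elt :: "('i \<Rightarrow> 'i \<Rightarrow> int) \<Rightarrow> ('i \<Rightarrow> complex) \<Rightarrow> 'i \<Rightarrow> 'i chevalley lie_term set" where
  "u_elt A a i =
    km_e A i \<oplus>\<^bsub>kac_moody A\<^esub> a i \<odot>\<^bsub>kac_moody A\<^esub> br\<^bsub>kac_moody A\<^esub> (km_e A i) (km_f A i)
      \<ominus>\<^bsub>kac_moody A\<^esub> (a i)\<^sup>2 \<odot>\<^bsub>kac_moody A\<^esub> km_f A i"

definition bold_f :: "('i \<Rightarrow> 'i \<Rightarrow> int) \<Rightarrow> 'i \<Rightarrow> ('i \<Rightarrow> complex) \<Rightarrow> 'i chevalley lie_term set" where
  "bold_f A r a =
    finsum (kac_moody A) (\<lambda>j. a j \<odot>\<^bsub>kac_moody A\<^esub> km_f A j) (children (gamma_edge A) r r)"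

text \<open>The factor of the root comes first; the other factors follow in the order of \<open>js\<close>.\<close>

definition Ad_g :: "('i \<Rightarrow> 'i \<Rightarrow> int) \<Rightarrow> 'i \<Rightarrow> ('i \<Rightarrow> complex) \<Rightarrow> 'i list
    \<Rightarrow> 'i chevalley lie_term set \<Rightarrow> 'i chevalley lie_term set" where
  "Ad_g A r a js = Ad_prod (kac_moody A) (map (\<lambda>i. a i \<odot>\<^bsub>kac_moody A\<^esub> km_f A i) (r # js))"

end

theory Submission
  imports Defs
begin

text \<open>
  For a non-root vertex \<open>i\<close> only the factors of \<open>i\<close> and of its child \<open>j\<close> act non-trivially: the
  factor of \<open>j\<close> adds multiples of \<open>f\<^sub>j\<close> and \<open>[f\<^sub>j, f\<^sub>i]\<close> to \<open>u\<^sub>i\<close>; then the factor of \<open>i\<close> turns \<open>u\<^sub>i\<close>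
  into \<open>e\<^sub>i\<close> and cancels the second multiple.  For the root, the factors of its children commute, so
  that the non-root factors take \<open>u\<^sub>0\<close> to \<open>e\<^sub>0 + a\<^sub>0 h\<^sub>0 - a\<^sub>0 ff - a\<^sub>0\<^sup>2 e\<^bsup>ad ff\<^esup> f\<^sub>0\<close>.  Since
  \<open>[f\<^sub>0, [f\<^sub>0, ff]] = 0\<close>, the factor of the root replaces \<open>ff\<close> by \<open>ff + a\<^sub>0 [f\<^sub>0, ff]\<close> here, and the
  terms of order at most two of the exponential simplify.
\<close>

section \<open>Paths in trees\<close>

text \<open>This is the uniqueness behind the \<open>THE\<close> in \<open>parent\<close>. Both
  paths end in \<open>r\<close>, so they meet; if \<open>j\<close> and \<open>j'\<close> differed,
  the parts up to a first common vertex would close up to a cycle.\<close>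

lemma graph_path_parent_eq:
  assumes "symp G" "\<nexists>p. graph_cycle G p"
    and p: "graph_path G (i # j # p)" "last (j # p) = r"
    and q: "graph_path G (i # j' # q)" "last (j' # q) = r"
  shows "j = j'"
proof (rule ccontr)
  assume ne: "j \<noteq> j'"
  have "\<exists>v\<in>set (j # p). v \<in> set (j' # q)"
    using p(2) q(2) last_in_set[of "j # p"] last_in_set[of "j' # q"] by (metis list.distinct(1))
  \<comment> \<open>Taking \<open>v\<close> as the first such vertex keeps \<open>xs\<close> off the
    second path, so the closed walk formed below repeats no vertex.\<close>
  then obtain xs v ys where xs: "j # p = xs @ v # ys" "v \<in> set (j' # q)"
    "\<forall>x\<in>set xs. x \<notin> set (j' # q)"
    by (rule split_list_first_propE)
  then obtain xs' ys' where xs': "j' # q = xs' @ v # ys'"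
    by (meson split_list)
  have P: "distinct (i # xs @ v # ys)" "successively G (i # xs @ v # ys)"
    using p(1) unfolding graph_path_def xs(1) by auto
  have Q: "distinct (i # xs' @ v # ys')" "successively G (i # xs' @ v # ys')"
    using q(1) unfolding graph_path_def xs' by auto
  \<comment> \<open>the cycle that follows one path up to their first common vertex \<open>v\<close> and returns along the other\<close>
  let ?c = "i # xs @ v # rev xs'"
  have "successively G ((i # xs @ [v]) @ ys)"
    using P(2) by simp
  then have 1: "successively G (i # xs @ [v])"
    by (simp only: successively_append_iff)
  have "successively G ((i # xs' @ [v]) @ ys')"
    using Q(2) by simp
  then have 2: "successively G (i # xs' @ [v])"
    by (simp only: successively_append_iff)
  have "successively (\<lambda>x y. G y x) (i # xs' @ [v])"
    using 2 assms(1) by (metis (mono_tags, lifting) successively_mono sympD)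
  then have "successively G (rev (i # xs' @ [v]))"
    by (simp only: successively_rev)
  then have 3: "successively G ((v # rev xs') @ [i])"
    by simp
  have "successively G ((i # xs) @ v # rev xs')"
    using 1 3 unfolding successively_append_iff append_Cons[symmetric] by (auto simp: successively_append_iff)
  moreover have "G (last ?c) i"
    using 3 by (auto simp: successively_append_iff successively_Cons)
  moreover have "distinct ?c"
    using P(1) Q(1) xs(3) unfolding xs' by auto
  \<comment> \<open>If \<open>xs\<close> and \<open>xs'\<close> were both empty, then
    \<open>j = v = j'\<close>; so there is a third vertex besides \<open>i\<close> and
    \<open>v\<close>.\<close>
  moreover have "length ?c \<ge> 3"
    using ne xs(1) xs' by (cases xs; cases xs') auto
  ultimately have "graph_cycle G ?c"
    unfolding graph_cycle_def graph_path_def by simp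
  then show False
    using assms(2) by blast
qed

lemma parent_eqI:
  assumes "symp G" "graph_tree G" "graph_path G (i # j # p)" "last (j # p) = r"
  shows "parent G r i = j"
  unfolding parent_def
  using assms graph_path_parent_eq[OF assms(1)] unfolding graph_tree_def
  by (intro the_equality) blast+

lemma parent_edge:
  assumes "symp G" "graph_tree G" "i \<noteq> r"
  shows "G i (parent G r i)"
proof -
  obtain p where p: "graph_path G p" "hd p = i" "last p = r"
    using assms(2) unfolding graph_tree_def by blast
  \<comment> \<open>\<open>remdups_adj.cases\<close> serves only as the split into lists of length
    0, 1 and at least 2; length 1 would force \<open>i = r\<close>.\<close>
  then obtain j q where "p = i # j # q"
    using assms(3) by (cases p rule: remdups_adj.cases) (auto simp: graph_path_def)
  then show ?thesis
    using p parent_eqI[OF assms(1,2), of i j q r] by (auto simp: graph_path_def)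
qed

text \<open>If a path from \<open>k\<close> to \<open>r\<close> contains \<open>l\<close>, jumping
  straight from \<open>k\<close> to \<open>l\<close> shows that \<open>l\<close> is the parent of
  \<open>k\<close>. If it avoids \<open>l\<close>, putting \<open>l\<close> in front shows that
  \<open>k\<close> is the parent of \<open>l\<close>.\<close>

lemma edge_imp_child:
  assumes "symp G" "irreflp G" "graph_tree G" "G k l"
  shows "k \<in> children G r l \<or> l \<in> children G r k"
proof -
  obtain p where p: "graph_path G p" "hd p = k" "last p = r"
    using assms(3) unfolding graph_tree_def by blast
  then obtain q where q: "p = k # q"
    by (cases p) (auto simp: graph_path_def)
  show ?thesis
  proof (cases "l \<in> set p")
    case True
    have "l \<noteq> k"
      using assms(2,4) by (auto dest: irreflpD)
    then obtain xs ys where xs: "q = xs @ l # ys"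
      using True q by (metis set_ConsD split_list)
    have "graph_path G (k # l # ys)"
      using p(1) assms(4) unfolding graph_path_def q xs by (auto simp: successively_append_iff successively_Cons)
    moreover have last: "last (l # ys) = r"
      using p(3) unfolding q xs by simp
    moreover have "k \<noteq> r"
    proof -
      have "k \<notin> set (l # ys)"
        using p(1) unfolding q xs graph_path_def by simp
      then show ?thesis
        using last last_in_set[of "l # ys"] by (metis list.distinct(1))
    qed
    ultimately show ?thesis
      using parent_eqI[OF assms(1,3)] by (auto simp: children_def)
  next
    case False
    have "l \<noteq> r"
      using False p(3) last_in_set[of p] q by (metis list.distinct(1))
    moreover have "graph_path G (l # k # q)"
      using False p assms(1,4) unfolding graph_path_def q by (auto dest: sympD)
    ultimately show ?thesis
      using parent_eqI[OF assms(1,3)] p(3) unfolding q by (auto simp: children_def)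
  qed
qed

section \<open>Exponentials of locally nilpotent derivations\<close>

lemma complex_ring_simps [simp]:
  "carrier complex_ring = UNIV" "\<zero>\<^bsub>complex_ring\<^esub> = 0" "\<one>\<^bsub>complex_ring\<^esub> = 1"
  "c \<oplus>\<^bsub>complex_ring\<^esub> d = c + d" "c \<otimes>\<^bsub>complex_ring\<^esub> d = c * d"
  by (simp_all add: complex_ring_def)

text \<open>The triangle \<open>i + j < n\<close> is summed by antidiagonals on the left and by rows
  on the right; the induction step adds the antidiagonal \<open>i + j = n\<close>.\<close>

lemma (in abelian_monoid) finsum_triangle:
  fixes T :: "nat \<Rightarrow> nat \<Rightarrow> 'a"
  assumes T: "\<And>i j. T i j \<in> carrier G"
  shows "(\<Oplus>k\<in>{..<n}. \<Oplus>i\<in>{..k}. T i (k - i)) = (\<Oplus>i\<in>{..<n}. \<Oplus>j\<in>{..<n - i}. T i j)"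
proof (induction n)
  case (Suc n)
  have "(\<Oplus>i\<in>{..<Suc n}. \<Oplus>j\<in>{..<Suc n - i}. T i j)
      = (\<Oplus>i\<in>{..<Suc n}. T i (n - i) \<oplus> (\<Oplus>j\<in>{..<n - i}. T i j))"
    using T by (intro finsum_cong') (auto simp: Suc_diff_le lessThan_Suc)
  also have "\<dots> = (\<Oplus>i\<in>{..<Suc n}. T i (n - i)) \<oplus> (\<Oplus>i\<in>{..<Suc n}. \<Oplus>j\<in>{..<n - i}. T i j)"
    using T by (intro finsum_addf) auto
  also have "(\<Oplus>i\<in>{..<Suc n}. \<Oplus>j\<in>{..<n - i}. T i j) = (\<Oplus>i\<in>{..<n}. \<Oplus>j\<in>{..<n - i}. T i j)"
    using T by (simp add: lessThan_Suc Pi_def)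
  finally have "(\<Oplus>i\<in>{..<Suc n}. \<Oplus>j\<in>{..<Suc n - i}. T i j)
      = (\<Oplus>i\<in>{..n}. T i (n - i)) \<oplus> (\<Oplus>i\<in>{..<n}. \<Oplus>j\<in>{..<n - i}. T i j)"
    by (simp only: lessThan_Suc_atMost)
  moreover have "(\<Oplus>k\<in>{..<Suc n}. \<Oplus>i\<in>{..k}. T i (k - i))
      = (\<Oplus>i\<in>{..n}. T i (n - i)) \<oplus> (\<Oplus>k\<in>{..<n}. \<Oplus>i\<in>{..k}. T i (k - i))"
    unfolding lessThan_Suc using T by (subst finsum_insert) auto
  ultimately show ?case
    by (simp only: Suc.IH)
qed simp

text \<open>The reordering behind a Cauchy product of two finite series: the entries of the square
  outside the triangle \<open>i + j < n\<close> vanish.\<close>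

lemma (in abelian_monoid) finsum_diagonal:
  fixes T :: "nat \<Rightarrow> nat \<Rightarrow> 'a"
  assumes T: "\<And>i j. T i j \<in> carrier G" and z: "\<And>i j. i + j \<ge> n \<Longrightarrow> T i j = \<zero>"
  shows "(\<Oplus>k\<in>{..<n}. \<Oplus>i\<in>{..k}. T i (k - i)) = (\<Oplus>i\<in>{..<n}. \<Oplus>j\<in>{..<n}. T i j)"
  unfolding finsum_triangle[of T, OF T]
  using T z by (intro finsum_cong' add.finprod_mono_neutral_cong_left) auto

context complex_lie_algebra
begin

section \<open>Scalars, bilinearity and the Leibniz rule\<close>

lemma scale_closed [simp]: "x \<in> carrier L \<Longrightarrow> c \<odot> x \<in> carrier L"
  by simp

lemma scale_add_left: "x \<in> carrier L \<Longrightarrow> (c + d) \<odot> x = c \<odot> x \<oplus> d \<odot> x"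
  using smult_l_distr[of c d x] by simp

lemma scale_add_right:
  "x \<in> carrier L \<Longrightarrow> y \<in> carrier L \<Longrightarrow> c \<odot> (x \<oplus> y) = c \<odot> x \<oplus> c \<odot> y"
  using smult_r_distr[of c x y] by simp

lemma scale_scale: "x \<in> carrier L \<Longrightarrow> c \<odot> (d \<odot> x) = (c * d) \<odot> x"
  using smult_assoc1[of c d x] by simp

lemma scale_one [simp]: "x \<in> carrier L \<Longrightarrow> 1 \<odot> x = x"
  using smult_one[of x] by simp

lemma scale_zero [simp]: "x \<in> carrier L \<Longrightarrow> 0 \<odot> x = \<zero>" "c \<odot> \<zero> = \<zero>"
  using smult_l_null[of x] smult_r_null[of c] by simp_all

lemma minus_eq_scale: "x \<in> carrier L \<Longrightarrow> \<ominus> x = (-1) \<odot> x"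
  using scale_add_left[of x "-1" 1] by (intro minus_equality) auto

lemma diff_eq_scale: "x \<in> carrier L \<Longrightarrow> y \<in> carrier L \<Longrightarrow> x \<ominus> y = x \<oplus> (-1) \<odot> y"
  by (simp add: a_minus_def minus_eq_scale)

lemma scale_finsum:
  "f \<in> A \<rightarrow> carrier L \<Longrightarrow> c \<odot> (\<Oplus>i\<in>A. f i) = (\<Oplus>i\<in>A. c \<odot> f i)"
  using finsum_smult_ldistr[of A c f] by (cases "finite A") auto

declare br_closed [simp]

lemma br_zero [simp]: "x \<in> carrier L \<Longrightarrow> br x \<zero> = \<zero>" "x \<in> carrier L \<Longrightarrow> br \<zero> x = \<zero>"
  using br_smult_right[of x \<zero> 0] br_smult_left[of \<zero> x 0] by simp_all

lemma br_skew:
  assumes "x \<in> carrier L" "y \<in> carrier L"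
  shows "br y x = (-1) \<odot> br x y"
proof -
  have "br x y \<oplus> br y x = \<zero>"
    using assms br_self[of "x \<oplus> y"] br_self[of x] br_self[of y]
    by (simp add: br_add_left br_add_right a_comm)
  then show ?thesis
    using assms minus_equality[of "br y x" "br x y"] by (simp add: a_comm minus_eq_scale)
qed

text \<open>Jacobi and skew symmetry together make \<open>ad x\<close> a derivation, the form used
  below.\<close>

lemma br_leibniz:
  assumes "x \<in> carrier L" "y \<in> carrier L" "z \<in> carrier L"
  shows "br x (br y z) = br (br x y) z \<oplus> br y (br x z)"
proof -
  have "br x (br y z) \<oplus> (br y (br z x) \<oplus> br z (br x y)) = \<zero>"
    using br_jacobi[OF assms] assms by (simp add: a_assoc)
  then have "\<ominus> (br y (br z x) \<oplus> br z (br x y)) = br x (br y z)"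
    using assms by (intro minus_equality) auto
  moreover have "br z x = (-1) \<odot> br x z" "br z (br x y) = (-1) \<odot> br (br x y) z"
    using assms by (simp_all add: br_skew[of _ z])
  ultimately show ?thesis
    using assms by (simp add: minus_eq_scale br_smult_right scale_add_right scale_scale a_comm)
qed

lemma br_finsum:
  "x \<in> carrier L \<Longrightarrow> f \<in> A \<rightarrow> carrier L \<Longrightarrow> br x (\<Oplus>i\<in>A. f i) = (\<Oplus>i\<in>A. br x (f i))"
  by (induction A rule: infinite_finite_induct) (auto simp: br_add_right Pi_def)

section \<open>Powers of \<open>ad x\<close>\<close>

lemma ad_pow_closed [simp]: "x \<in> carrier L \<Longrightarrow> y \<in> carrier L \<Longrightarrow> (br x ^^ k) y \<in> carrier L"
  by (induction k) auto

lemma ad_pow_zero [simp]: "x \<in> carrier L \<Longrightarrow> (br x ^^ k) \<zero> = \<zero>"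
  by (induction k) auto

lemma ad_pow_mono:
  assumes "x \<in> carrier L" "(br x ^^ n) y = \<zero>" "n \<le> m"
  shows "(br x ^^ m) y = \<zero>"
  using assms funpow_add[of "m - n" n "br x"] by auto

lemma ad_pow_add:
  "x \<in> carrier L \<Longrightarrow> y \<in> carrier L \<Longrightarrow> z \<in> carrier L
    \<Longrightarrow> (br x ^^ k) (y \<oplus> z) = (br x ^^ k) y \<oplus> (br x ^^ k) z"
  by (induction k) (auto simp: br_add_right)

lemma ad_pow_scale:
  "x \<in> carrier L \<Longrightarrow> y \<in> carrier L \<Longrightarrow> (br x ^^ k) (c \<odot> y) = c \<odot> (br x ^^ k) y"
  by (induction k) (auto simp: br_smult_right)

lemma ad_pow_scale_left:
  "x \<in> carrier L \<Longrightarrow> y \<in> carrier L \<Longrightarrow> (br (c \<odot> x) ^^ k) y = c ^ k \<odot> (br x ^^ k) y"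
  by (induction k) (auto simp: br_smult_right br_smult_left scale_scale mult.commute)

lemma ad_pow_finsum:
  "x \<in> carrier L \<Longrightarrow> f \<in> A \<rightarrow> carrier L
    \<Longrightarrow> (br x ^^ k) (\<Oplus>i\<in>A. f i) = (\<Oplus>i\<in>A. (br x ^^ k) (f i))"
  by (induction k) (auto simp: br_finsum Pi_def)

lemma ad_commute:
  "x \<in> carrier L \<Longrightarrow> y \<in> carrier L \<Longrightarrow> z \<in> carrier L \<Longrightarrow> br x y = \<zero>
    \<Longrightarrow> br x (br y z) = br y (br x z)"
  by (simp add: br_leibniz[of x y z])

lemma ad_pow_commute:
  assumes "x \<in> carrier L" "y \<in> carrier L" "z \<in> carrier L" "br x y = \<zero>"
  shows "(br x ^^ m) ((br y ^^ n) z) = (br y ^^ n) ((br x ^^ m) z)"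
proof -
  have 1: "br x ((br y ^^ n) w) = (br y ^^ n) (br x w)" if "w \<in> carrier L" for w
    using that assms by (induction n) (simp_all add: ad_commute[of x y])
  show ?thesis
    using assms by (induction m) (simp_all add: 1)
qed

section \<open>Exponentials as finite sums\<close>

lemma supp_sum_eq:
  assumes "finite B" "B \<subseteq> K" "t \<in> B \<rightarrow> carrier L" "\<And>k. k \<in> K - B \<Longrightarrow> t k = \<zero>"
  shows "supp_sum L t K = (\<Oplus>k\<in>B. t k)"
  unfolding supp_sum_def
  using assms by (intro add.finprod_mono_neutral_cong_left) auto

text \<open>Nilpotency at a single vector makes the series of \<open>exp_ad L x y\<close> finite. It
  is tracked vector by vector alongside each exponential, in place of local nilpotency on the whole
  algebra.\<close>

definition ad_nilp :: "'a \<Rightarrow> 'a \<Rightarrow> bool" where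
  "ad_nilp x y \<longleftrightarrow> (\<exists>n. (br x ^^ n) y = \<zero>)"

text \<open>The bound \<open>n\<close> may be any exponent that kills \<open>y\<close>, so several
  exponentials can be summed over one common range.\<close>

lemma exp_ad_eq:
  assumes "x \<in> carrier L" "y \<in> carrier L" "(br x ^^ n) y = \<zero>"
  shows "exp_ad L x y = (\<Oplus>k\<in>{..<n}. (1 / fact k) \<odot> (br x ^^ k) y)"
  unfolding exp_ad_def
  using assms ad_pow_mono[of x n y] by (intro supp_sum_eq) auto

lemma exp_ad_closed:
  assumes "x \<in> carrier L" "y \<in> carrier L" "ad_nilp x y"
  shows "exp_ad L x y \<in> carrier L"
  using assms unfolding ad_nilp_def by (auto simp: exp_ad_eq Pi_def)

lemma ad_nilp_common:
  assumes "x \<in> carrier L" "ad_nilp x y" "ad_nilp x z"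
  obtains n where "(br x ^^ n) y = \<zero>" "(br x ^^ n) z = \<zero>"
proof -
  obtain m k where "(br x ^^ m) y = \<zero>" "(br x ^^ k) z = \<zero>"
    using assms unfolding ad_nilp_def by blast
  then show thesis
    using that[of "max m k"] assms by (meson ad_pow_mono max.cobounded1 max.cobounded2)
qed

lemma ad_nilp_add:
  assumes "x \<in> carrier L" "y \<in> carrier L" "z \<in> carrier L" "ad_nilp x y" "ad_nilp x z"
  shows "ad_nilp x (y \<oplus> z)"
  using ad_nilp_common[OF assms(1,4,5)] assms unfolding ad_nilp_def
  by (metis ad_pow_add l_zero zero_closed)

lemma ad_nilp_scale:
  "x \<in> carrier L \<Longrightarrow> y \<in> carrier L \<Longrightarrow> ad_nilp x y \<Longrightarrow> ad_nilp x (c \<odot> y)"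
  unfolding ad_nilp_def by (metis ad_pow_scale scale_zero(2))

lemma exp_ad_add:
  assumes "x \<in> carrier L" "y \<in> carrier L" "z \<in> carrier L" "ad_nilp x y" "ad_nilp x z"
  shows "exp_ad L x (y \<oplus> z) = exp_ad L x y \<oplus> exp_ad L x z"
proof -
  obtain n where n: "(br x ^^ n) y = \<zero>" "(br x ^^ n) z = \<zero>"
    using ad_nilp_common assms by blast
  then have "(br x ^^ n) (y \<oplus> z) = \<zero>"
    using assms by (simp add: ad_pow_add)
  then show ?thesis
    using assms n by (simp add: exp_ad_eq[where n = n] ad_pow_add scale_add_right finsum_addf Pi_def)
qed

lemma exp_ad_scale:
  assumes "x \<in> carrier L" "y \<in> carrier L" "ad_nilp x y"
  shows "exp_ad L x (c \<odot> y) = c \<odot> exp_ad L x y"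
proof -
  obtain n where n: "(br x ^^ n) y = \<zero>"
    using assms unfolding ad_nilp_def by blast
  then show ?thesis
    using assms by (simp add: exp_ad_eq[where n = n] ad_pow_scale scale_finsum scale_scale Pi_def mult.commute)
qed

lemma ad_nilp_finsum:
  assumes "x \<in> carrier L" "f \<in> A \<rightarrow> carrier L" "\<And>i. i \<in> A \<Longrightarrow> ad_nilp x (f i)"
  shows "ad_nilp x (\<Oplus>i\<in>A. f i)"
proof -
  have z: "ad_nilp x \<zero>"
    unfolding ad_nilp_def by (intro exI[of _ 0]) simp
  show ?thesis
    using assms by (induction A rule: infinite_finite_induct) (auto simp: z ad_nilp_add)
qed

lemma exp_ad_zero [simp]: "x \<in> carrier L \<Longrightarrow> exp_ad L x \<zero> = \<zero>"
  using exp_ad_eq[of x \<zero> 0] by simp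

lemma exp_ad_finsum:
  assumes "x \<in> carrier L" "f \<in> A \<rightarrow> carrier L" "\<And>i. i \<in> A \<Longrightarrow> ad_nilp x (f i)"
  shows "exp_ad L x (\<Oplus>i\<in>A. f i) = (\<Oplus>i\<in>A. exp_ad L x (f i))"
  using assms
  by (induction A rule: infinite_finite_induct)
     (auto simp: exp_ad_add ad_nilp_finsum exp_ad_closed Pi_def)

section \<open>Series that stop at the constant, linear or quadratic term\<close>

lemma exp_ad_fixed:
  assumes "x \<in> carrier L" "y \<in> carrier L" "br x y = \<zero>"
  shows "ad_nilp x y" "exp_ad L x y = y"
proof -
  have 1: "(br x ^^ 1) y = \<zero>"
    using assms by simp
  show "ad_nilp x y"
    unfolding ad_nilp_def using 1 by blast
  show "exp_ad L x y = y"
    using exp_ad_eq[OF assms(1,2) 1] assms by (simp add: lessThan_Suc)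
qed

lemma exp_ad_linear:
  assumes "x \<in> carrier L" "y \<in> carrier L" "br x (br x y) = \<zero>"
  shows "ad_nilp x y" "exp_ad L x y = y \<oplus> br x y"
proof -
  have 1: "(br x ^^ 2) y = \<zero>"
    using assms by (simp add: numeral_2_eq_2)
  show "ad_nilp x y"
    unfolding ad_nilp_def using 1 by blast
  show "exp_ad L x y = y \<oplus> br x y"
    using exp_ad_eq[OF assms(1,2) 1] assms by (simp add: numeral_2_eq_2 lessThan_Suc a_comm)
qed

lemma exp_ad_quadratic:
  assumes "x \<in> carrier L" "y \<in> carrier L" "br x (br x (br x y)) = \<zero>"
  shows "ad_nilp x y" "exp_ad L x y = y \<oplus> br x y \<oplus> (1 / 2) \<odot> br x (br x y)"
proof -
  have 1: "(br x ^^ 3) y = \<zero>"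
    using assms by (simp add: numeral_3_eq_3)
  show "ad_nilp x y"
    unfolding ad_nilp_def using 1 by blast
  show "exp_ad L x y = y \<oplus> br x y \<oplus> (1 / 2) \<odot> br x (br x y)"
    using exp_ad_eq[OF assms(1,2) 1] assms by (simp add: numeral_3_eq_3 lessThan_Suc a_ac)
qed

section \<open>Divided powers and products of commuting exponentials\<close>

lemma ad_divided_power_step:
  assumes "x \<in> carrier L" "y \<in> carrier L"
  shows "br x ((1 / fact k) \<odot> (br x ^^ k) y)
    = of_nat (Suc k) \<odot> ((1 / fact (Suc k)) \<odot> (br x ^^ Suc k) y)"
proof -
  have "of_nat (Suc k) * (1 / fact (Suc k)) = (1 / fact k :: complex)"
    by (simp del: of_nat_Suc)
  then show ?thesis
    using assms by (simp add: br_smult_right scale_scale del: of_nat_Suc fact_Suc times_divide_eq_right)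
qed

text \<open>The binomial theorem for the commuting operators \<open>ad x\<close> and
  \<open>ad y\<close>, where divided powers absorb the binomial coefficients. In the induction step
  a term of degree \<open>k + 1\<close> arises with weight \<open>i\<close> from \<open>x\<close>
  and \<open>k + 1 - i\<close> from \<open>y\<close>.\<close>

lemma ad_divided_power_add:
  assumes "x \<in> carrier L" "y \<in> carrier L" "z \<in> carrier L" "br x y = \<zero>"
  shows "(1 / fact k) \<odot> (br (x \<oplus> y) ^^ k) z
    = (\<Oplus>i\<in>{..k}. (1 / fact i) \<odot> (br x ^^ i) ((1 / fact (k - i)) \<odot> (br y ^^ (k - i)) z))"
proof (induction k)
  case 0
  then show ?case using assms by simp
next
  case (Suc k)
  define T where "T i j = (1 / fact i) \<odot> (br x ^^ i) ((1 / fact j) \<odot> (br y ^^ j) z)" for i j :: nat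
  have T [simp]: "T i j \<in> carrier L" for i j
    using assms by (simp add: T_def)
  \<comment> \<open>Since \<open>ad x\<close> and \<open>ad y\<close> commute, the power of
    \<open>y\<close> may also stand outermost, so that bracketing with \<open>y\<close> raises the
    second index.\<close>
  have T': "T i j = (1 / fact j) \<odot> (br y ^^ j) ((1 / fact i) \<odot> (br x ^^ i) z)" for i j
    using assms ad_pow_commute[of x y z i j] by (simp add: T_def ad_pow_scale scale_scale mult.commute)
  have x: "br x (T i j) = of_nat (Suc i) \<odot> T (Suc i) j" for i j
    unfolding T_def by (rule ad_divided_power_step) (use assms in auto)
  have y: "br y (T i j) = of_nat (Suc j) \<odot> T i (Suc j)" for i j
    unfolding T' by (rule ad_divided_power_step) (use assms in auto)
  have "of_nat (Suc k) \<odot> ((1 / fact (Suc k)) \<odot> (br (x \<oplus> y) ^^ Suc k) z)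
      = br (x \<oplus> y) (\<Oplus>i\<in>{..k}. T i (k - i))"
    using ad_divided_power_step[of "x \<oplus> y" z k] assms Suc.IH by (simp add: T_def)
  also have "\<dots> = (\<Oplus>i\<in>{..k}. br x (T i (k - i))) \<oplus> (\<Oplus>i\<in>{..k}. br y (T i (k - i)))"
    using assms by (simp add: br_add_left br_finsum Pi_def)
  \<comment> \<open>After the shift of the index the new term \<open>i = 0\<close> has coefficient
    0; so has the term \<open>i = Suc k\<close> that is added to the other sum. Both sums then have
    the same range.\<close>
  also have "(\<Oplus>i\<in>{..k}. br x (T i (k - i))) = (\<Oplus>i\<in>{..Suc k}. of_nat i \<odot> T i (Suc k - i))"
    using assms by (subst finsum_Suc2) (auto simp: x simp del: finsum_Suc of_nat_Suc)
  also have "(\<Oplus>i\<in>{..k}. br y (T i (k - i))) = (\<Oplus>i\<in>{..k}. of_nat (Suc k - i) \<odot> T i (Suc k - i))"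
    by (intro finsum_cong') (auto simp: y Suc_diff_le)
  also have "\<dots> = (\<Oplus>i\<in>{..Suc k}. of_nat (Suc k - i) \<odot> T i (Suc k - i))"
    by (simp add: Pi_def)
  also have "(\<Oplus>i\<in>{..Suc k}. of_nat i \<odot> T i (Suc k - i)) \<oplus> \<dots>
      = (\<Oplus>i\<in>{..Suc k}. of_nat i \<odot> T i (Suc k - i) \<oplus> of_nat (Suc k - i) \<odot> T i (Suc k - i))"
    by (simp add: finsum_addf del: finsum_Suc)
  also have "\<dots> = (\<Oplus>i\<in>{..Suc k}. of_nat (Suc k) \<odot> T i (Suc k - i))"
    by (intro finsum_cong')
       (auto simp flip: scale_add_left of_nat_add)
  also have "\<dots> = of_nat (Suc k) \<odot> (\<Oplus>i\<in>{..Suc k}. T i (Suc k - i))"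
    by (intro scale_finsum[symmetric]) auto
  \<comment> \<open>The calculation gives the claim multiplied by \<open>Suc k\<close>; this factor
    is divided out.\<close>
  finally have "(1 / of_nat (Suc k)) \<odot> (of_nat (Suc k) \<odot> ((1 / fact (Suc k)) \<odot> (br (x \<oplus> y) ^^ Suc k) z))
     = (1 / of_nat (Suc k)) \<odot> (of_nat (Suc k) \<odot> (\<Oplus>i\<in>{..Suc k}. T i (Suc k - i)))"
    by (rule arg_cong)
  then show ?case
    using assms unfolding T_def[symmetric]
    by (subst (asm) (1 2) scale_scale) (auto simp del: of_nat_Suc finsum_Suc)
qed

text \<open>Expanding both series gives a square array of products of divided powers, whose
  antidiagonals are the divided powers of \<open>x \<oplus> y\<close> by
  \<open>ad_divided_power_add\<close>.\<close>

lemma exp_ad_commuting: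
  assumes "x \<in> carrier L" "y \<in> carrier L" "z \<in> carrier L" "br x y = \<zero>" "ad_nilp x z" "ad_nilp y z"
  shows "ad_nilp (x \<oplus> y) z" "ad_nilp x (exp_ad L y z)"
    "exp_ad L x (exp_ad L y z) = exp_ad L (x \<oplus> y) z"
proof -
  obtain m n where m: "(br x ^^ m) z = \<zero>" and n: "(br y ^^ n) z = \<zero>"
    using assms unfolding ad_nilp_def by blast
  \<comment> \<open>If \<open>i + j \<ge> N\<close>, then \<open>m \<le> i\<close> or
    \<open>n \<le> j\<close>, and by commutativity the power that kills \<open>z\<close> can act
    first.\<close>
  define N where "N = m + n"
  define T where "T i j = (1 / fact i) \<odot> (br x ^^ i) ((1 / fact j) \<odot> (br y ^^ j) z)" for i j :: nat
  have T [simp]: "T i j \<in> carrier L" for i j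
    using assms by (simp add: T_def)
  have zx: "(br x ^^ i) z = \<zero>" if "m \<le> i" for i
    using ad_pow_mono m that assms by blast
  have zy: "(br y ^^ j) z = \<zero>" if "n \<le> j" for j
    using ad_pow_mono n that assms by blast
  have z: "T i j = \<zero>" if "N \<le> i + j" for i j
  proof -
    have "m \<le> i \<or> n \<le> j"
      using that unfolding N_def by linarith
    then have "(br x ^^ i) ((br y ^^ j) z) = \<zero>"
      using assms zx[of i] zy[of j] ad_pow_commute[of x y z i j] by (metis ad_pow_zero)
    then show ?thesis
      using assms by (simp add: T_def ad_pow_scale)
  qed
  have dp: "(1 / fact k) \<odot> (br (x \<oplus> y) ^^ k) z = (\<Oplus>i\<in>{..k}. T i (k - i))" for k
    unfolding T_def by (rule ad_divided_power_add) fact+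
  have "(1 / fact N) \<odot> (br (x \<oplus> y) ^^ N) z = \<zero>"
    unfolding dp using z by (intro add.finprod_one_eqI) auto
  then have "fact N \<odot> ((1 / fact N) \<odot> (br (x \<oplus> y) ^^ N) z) = \<zero>"
    by simp
  then have s: "(br (x \<oplus> y) ^^ N) z = \<zero>"
    using assms by (subst (asm) scale_scale) auto
  then show "ad_nilp (x \<oplus> y) z"
    unfolding ad_nilp_def by blast
  have ey: "exp_ad L y z = (\<Oplus>j\<in>{..<N}. (1 / fact j) \<odot> (br y ^^ j) z)"
    using assms zy[of N] by (intro exp_ad_eq) (auto simp: N_def)
  have xN: "(br x ^^ N) ((br y ^^ j) z) = \<zero>" for j
    using assms zx[of N] by (simp add: ad_pow_commute N_def)
  have xy: "(br x ^^ N) (exp_ad L y z) = \<zero>"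
    unfolding ey using assms by (simp add: ad_pow_finsum ad_pow_scale xN Pi_def)
  then show "ad_nilp x (exp_ad L y z)"
    unfolding ad_nilp_def by blast
  have "exp_ad L x (exp_ad L y z) = (\<Oplus>i\<in>{..<N}. (1 / fact i) \<odot> (br x ^^ i) (exp_ad L y z))"
    using assms xy by (intro exp_ad_eq exp_ad_closed) auto
  also have "\<dots> = (\<Oplus>i\<in>{..<N}. \<Oplus>j\<in>{..<N}. T i j)"
    unfolding ey using assms
    by (intro finsum_cong') (auto simp: T_def ad_pow_finsum scale_finsum Pi_def)
  also have "\<dots> = (\<Oplus>k\<in>{..<N}. \<Oplus>i\<in>{..k}. T i (k - i))"
    using z by (intro finsum_diagonal[symmetric]) auto
  also have "\<dots> = exp_ad L (x \<oplus> y) z"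
    using assms s by (simp add: exp_ad_eq[where n = N] dp)
  finally show "exp_ad L x (exp_ad L y z) = exp_ad L (x \<oplus> y) z" .
qed

section \<open>Exponentials as automorphisms\<close>

text \<open>The Leibniz expansion keeps only two terms because \<open>(ad x)^2\<close> kills
  \<open>y\<close>; \<open>Suc k\<close> is the binomial coefficient of the second.\<close>

lemma ad_pow_br:
  assumes "x \<in> carrier L" "y \<in> carrier L" "z \<in> carrier L" "br x (br x y) = \<zero>"
  shows "(br x ^^ Suc k) (br y z)
    = br y ((br x ^^ Suc k) z) \<oplus> of_nat (Suc k) \<odot> br (br x y) ((br x ^^ k) z)"
proof (induction k)
  case 0
  then show ?case
    using assms by (simp add: br_leibniz[of x y z] a_comm)
next
  case (Suc k)
  define g where "g = br x y"
  have g: "g \<in> carrier L" "br x g = \<zero>"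
    using assms by (auto simp: g_def)
  have "(br x ^^ Suc (Suc k)) (br y z) = br x ((br x ^^ Suc k) (br y z))"
    by simp
  also have "\<dots> = br x (br y ((br x ^^ Suc k) z)) \<oplus> of_nat (Suc k) \<odot> br x (br g ((br x ^^ k) z))"
    unfolding Suc.IH g_def[symmetric] using assms g
    by (simp add: br_add_right br_smult_right del: of_nat_Suc)
  also have "br x (br y ((br x ^^ Suc k) z)) = br y ((br x ^^ Suc (Suc k)) z) \<oplus> br g ((br x ^^ Suc k) z)"
    using assms br_leibniz[of x y "(br x ^^ Suc k) z"] by (simp add: g_def a_comm)
  \<comment> \<open>\<open>ad x\<close> commutes with \<open>ad g\<close> because
    \<open>[x, g] = 0\<close>. The \<open>Suc k\<close> copies join the single one from the previous
    step.\<close>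
  also have "br x (br g ((br x ^^ k) z)) = br g ((br x ^^ Suc k) z)"
    using assms g by (simp add: ad_commute)
  finally show ?case
    using assms g unfolding g_def[symmetric] of_nat_Suc[of "Suc k"]
    by (simp add: a_assoc scale_add_left del: of_nat_Suc)
qed

text \<open>As \<open>(ad x)^2\<close> kills \<open>y\<close>, the exponential sends
  \<open>y\<close> to \<open>y \<oplus> br x y\<close>; this is thus the automorphism property for
  brackets with left argument \<open>y\<close>.\<close>

lemma exp_ad_br:
  assumes "x \<in> carrier L" "y \<in> carrier L" "z \<in> carrier L" "br x (br x y) = \<zero>" "ad_nilp x z"
  shows "ad_nilp x (br y z)" "exp_ad L x (br y z) = br (y \<oplus> br x y) (exp_ad L x z)"
proof -
  obtain n where n: "(br x ^^ n) z = \<zero>"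
    using assms unfolding ad_nilp_def by blast
  have n': "(br x ^^ Suc n) (br y z) = \<zero>"
    unfolding ad_pow_br[OF assms(1-4)] using assms n by simp
  then show "ad_nilp x (br y z)"
    unfolding ad_nilp_def by blast
  \<comment> \<open>The coefficient \<open>Suc k\<close> turns \<open>1 / fact (Suc k)\<close> into
    \<open>1 / fact k\<close>, so the second part is the series of \<open>z\<close> again, shifted
    by one.\<close>
  have step: "(1 / fact (Suc k)) \<odot> (br x ^^ Suc k) (br y z)
    = br y ((1 / fact (Suc k)) \<odot> (br x ^^ Suc k) z) \<oplus> br (br x y) ((1 / fact k) \<odot> (br x ^^ k) z)" for k
    unfolding ad_pow_br[OF assms(1-4)] using assms
    by (simp add: scale_add_right scale_scale br_smult_right del: of_nat_Suc funpow.simps)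
  have "exp_ad L x (br y z) = (\<Oplus>k\<in>{..n}. (1 / fact k) \<odot> (br x ^^ k) (br y z))"
    using assms n' by (subst exp_ad_eq[OF _ _ n']) (auto simp: lessThan_Suc_atMost)
  also have "\<dots> = (\<Oplus>k\<in>{..n}. br y ((1 / fact k) \<odot> (br x ^^ k) z))
      \<oplus> (\<Oplus>k\<in>{..<n}. br (br x y) ((1 / fact k) \<odot> (br x ^^ k) z))"
  proof (cases n)
    case 0
    then show ?thesis using assms by simp
  next
    case (Suc m)
    show ?thesis
      unfolding Suc lessThan_Suc_atMost using assms
      by (subst (1 2) finsum_Suc2)
         (auto simp: step finsum_addf a_ac Pi_def simp del: funpow.simps(2) fact_Suc finsum_Suc)
  qed
  \<comment> \<open>The top term \<open>k = n\<close> vanishes by the choice of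
    \<open>n\<close>.\<close>
  also have "(\<Oplus>k\<in>{..n}. br y ((1 / fact k) \<odot> (br x ^^ k) z)) = (\<Oplus>k\<in>{..<n}. br y ((1 / fact k) \<odot> (br x ^^ k) z))"
    using assms n by (simp flip: lessThan_Suc_atMost add: lessThan_Suc Pi_def)
  also have "\<dots> = br y (exp_ad L x z)"
    using assms by (simp add: exp_ad_eq[OF _ _ n] br_finsum Pi_def)
  also have "(\<Oplus>k\<in>{..<n}. br (br x y) ((1 / fact k) \<odot> (br x ^^ k) z)) = br (br x y) (exp_ad L x z)"
    using assms by (simp add: exp_ad_eq[OF _ _ n] br_finsum Pi_def)
  finally show "exp_ad L x (br y z) = br (y \<oplus> br x y) (exp_ad L x z)"
    using assms by (simp add: br_add_left exp_ad_closed)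
qed

lemma exp_ad_ad_pow:
  assumes "x \<in> carrier L" "y \<in> carrier L" "z \<in> carrier L" "br x (br x y) = \<zero>" "ad_nilp x z"
  shows "ad_nilp x ((br y ^^ k) z) \<and>
    exp_ad L x ((br y ^^ k) z) = (br (y \<oplus> br x y) ^^ k) (exp_ad L x z)"
  using assms by (induction k) (auto simp: exp_ad_br)

text \<open>\<open>ad x\<close> commutes with \<open>ad y\<close>, so it passes through each term of
  the series to \<open>z\<close>, which it kills. This serves for non-root vertices that are not
  children of the root.\<close>

lemma br_exp_ad_eq_zero:
  assumes "x \<in> carrier L" "y \<in> carrier L" "z \<in> carrier L" "br x y = \<zero>" "br x z = \<zero>" "ad_nilp y z"
  shows "br x (exp_ad L y z) = \<zero>"
proof -
  obtain n where n: "(br y ^^ n) z = \<zero>"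
    using assms unfolding ad_nilp_def by blast
  have "br x ((br y ^^ k) z) = \<zero>" for k
    using assms ad_pow_commute[of x y z 1 k] by simp
  then show ?thesis
    using assms by (simp add: exp_ad_eq[OF _ _ n] br_finsum br_smult_right Pi_def)
qed

text \<open>Conjugation by the exponential of \<open>ad x\<close> replaces \<open>y\<close> by
  \<open>y \<oplus> br x y\<close>, and that exponential fixes \<open>z\<close>. This is how the
  root factor acts on the series left by its children.\<close>

lemma exp_ad_exp_ad:
  assumes "x \<in> carrier L" "y \<in> carrier L" "z \<in> carrier L" "br x (br x y) = \<zero>" "br x z = \<zero>"
    "ad_nilp y z"
  shows "ad_nilp x (exp_ad L y z)" "ad_nilp (y \<oplus> br x y) z"
    "exp_ad L x (exp_ad L y z) = exp_ad L (y \<oplus> br x y) z"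
proof -
  obtain n where n: "(br y ^^ n) z = \<zero>"
    using assms unfolding ad_nilp_def by blast
  have 1: "ad_nilp x ((br y ^^ k) z)" "exp_ad L x ((br y ^^ k) z) = (br (y \<oplus> br x y) ^^ k) z" for k
    using exp_ad_ad_pow[of x y z k] assms exp_ad_fixed[of x z] by simp_all
  \<comment> \<open>The left-hand side is the image of \<open>(br y ^^ n) z = \<zero>\<close> under
    the exponential, so the same \<open>n\<close> serves.\<close>
  have n': "(br (y \<oplus> br x y) ^^ n) z = \<zero>"
    using 1(2)[of n] n assms by simp
  then show "ad_nilp (y \<oplus> br x y) z"
    unfolding ad_nilp_def by blast
  have e: "exp_ad L y z = (\<Oplus>k\<in>{..<n}. (1 / fact k) \<odot> (br y ^^ k) z)"
    using assms n by (simp add: exp_ad_eq)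
  show "ad_nilp x (exp_ad L y z)"
    unfolding e using assms by (intro ad_nilp_finsum) (auto simp: 1 ad_nilp_scale)
  have "exp_ad L x (exp_ad L y z) = (\<Oplus>k\<in>{..<n}. exp_ad L x ((1 / fact k) \<odot> (br y ^^ k) z))"
    unfolding e using assms by (intro exp_ad_finsum) (auto simp: 1 ad_nilp_scale)
  also have "\<dots> = (\<Oplus>k\<in>{..<n}. (1 / fact k) \<odot> (br (y \<oplus> br x y) ^^ k) z)"
    using assms by (intro finsum_cong') (auto simp: exp_ad_scale 1)
  also have "\<dots> = exp_ad L (y \<oplus> br x y) z"
    using assms n' by (simp add: exp_ad_eq)
  finally show "exp_ad L x (exp_ad L y z) = exp_ad L (y \<oplus> br x y) z" .
qed

lemma Ad_prod_fixed:
  assumes "y \<in> carrier L" "\<And>x. x \<in> set xs \<Longrightarrow> x \<in> carrier L \<and> br x y = \<zero>"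
  shows "Ad_prod L xs y = y"
  using assms unfolding Ad_prod_def by (induction xs) (auto simp: exp_ad_fixed)

lemma Ad_prod_append: "Ad_prod L (xs @ ys) y = Ad_prod L xs (Ad_prod L ys y)"
  by (simp add: Ad_prod_def)

lemma Ad_prod_Cons: "Ad_prod L (x # xs) y = exp_ad L x (Ad_prod L xs y)"
  by (simp add: Ad_prod_def)

end

section \<open>Chevalley generators\<close>

text \<open>Stated for elements of an arbitrary complex Lie algebra, so that the computations are
  free of congruence classes; \<open>kac_moody A\<close> is put in at the end.\<close>

locale chevalley_relations = complex_lie_algebra L for L (structure) +
  fixes A :: "'i \<Rightarrow> 'i \<Rightarrow> int" and e f :: "'i \<Rightarrow> 'a"
  assumes e_closed [simp]: "e i \<in> carrier L" and f_closed [simp]: "f i \<in> carrier L"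
    and br_e_f: "i \<noteq> j \<Longrightarrow> br (e i) (f j) = \<zero>"
    and br_h_f: "br (br (e i) (f i)) (f j) = (- of_int (A i j)) \<odot> f j"
    and serre_f: "i \<noteq> j \<Longrightarrow> (br (f i) ^^ nat (1 - A i j)) (f j) = \<zero>"
    and diag: "A i i = 2"
begin

abbreviation h :: "'i \<Rightarrow> 'a" where "h i \<equiv> br (e i) (f i)"

lemma br_f_e: "i \<noteq> j \<Longrightarrow> br (f j) (e i) = \<zero>" "br (f i) (e i) = (-1) \<odot> h i"
  using br_skew[of "e i" "f j"] br_skew[of "e i" "f i"] by (simp_all add: br_e_f)

lemma br_f_h: "br (f j) (h i) = of_int (A i j) \<odot> f j"
  using br_skew[of "h i" "f j"] by (simp add: br_h_f scale_scale)

lemma br_f_self [simp]: "br (f i) (f i) = \<zero>"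
  by (simp add: br_self)

lemma br_f_f_eq_zero: "i \<noteq> j \<Longrightarrow> A i j = 0 \<Longrightarrow> br (f i) (f j) = \<zero>"
  using serre_f[of i j] by simp

lemma br_f_f_f_eq_zero: "i \<noteq> j \<Longrightarrow> A i j = -1 \<Longrightarrow> br (f i) (br (f i) (f j)) = \<zero>"
  using serre_f[of i j] by (simp add: numeral_2_eq_2)

text \<open>The Serre relation gives nilpotency for every value of \<open>A i j\<close>. This
  matters when \<open>j\<close> is the root, since that column is not restricted to 0 and
  -1.\<close>

lemma ad_nilp_f: "i \<noteq> j \<Longrightarrow> ad_nilp (c \<odot> f i) (f j)"
  using serre_f[of i j] unfolding ad_nilp_def by (metis ad_pow_scale_left f_closed scale_zero(2))

lemma exp_f_e:
  "ad_nilp (c \<odot> f i) (e i)"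
  "exp_ad L (c \<odot> f i) (e i) = e i \<oplus> (- c) \<odot> h i \<oplus> (- c\<^sup>2) \<odot> f i"
proof -
  have 1: "br (c \<odot> f i) (e i) = (- c) \<odot> h i"
    by (simp add: br_smult_left br_f_e scale_scale)
  \<comment> \<open>The factor 2 is the diagonal entry \<open>A i i\<close>; the
    \<open>1 / 2\<close> of the quadratic term cancels it.\<close>
  have 2: "br (c \<odot> f i) ((- c) \<odot> h i) = (- 2 * c\<^sup>2) \<odot> f i"
    by (simp add: br_smult_left br_smult_right br_f_h scale_scale diag power2_eq_square mult_ac)
  have 3: "br (c \<odot> f i) ((- 2 * c\<^sup>2) \<odot> f i) = \<zero>"
    by (simp add: br_smult_left br_smult_right)
  have 4: "br (c \<odot> f i) (br (c \<odot> f i) (br (c \<odot> f i) (e i))) = \<zero>"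
    unfolding 1 2 3 ..
  show "ad_nilp (c \<odot> f i) (e i)"
    using exp_ad_quadratic(1)[OF _ _ 4] by simp
  show "exp_ad L (c \<odot> f i) (e i) = e i \<oplus> (- c) \<odot> h i \<oplus> (- c\<^sup>2) \<odot> f i"
    using exp_ad_quadratic(2)[OF _ _ 4] unfolding 1 2 by (simp add: scale_scale)
qed

lemma exp_f_h:
  "ad_nilp (c \<odot> f j) (h i)"
  "exp_ad L (c \<odot> f j) (h i) = h i \<oplus> (c * of_int (A i j)) \<odot> f j"
proof -
  have 1: "br (c \<odot> f j) (h i) = (c * of_int (A i j)) \<odot> f j"
    by (simp add: br_smult_left br_f_h scale_scale)
  have 2: "br (c \<odot> f j) (br (c \<odot> f j) (h i)) = \<zero>"
    unfolding 1 by (simp add: br_smult_left br_smult_right)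
  show "ad_nilp (c \<odot> f j) (h i)"
    using exp_ad_linear(1)[OF _ _ 2] by simp
  show "exp_ad L (c \<odot> f j) (h i) = h i \<oplus> (c * of_int (A i j)) \<odot> f j"
    using exp_ad_linear(2)[OF _ _ 2] unfolding 1 by simp
qed

lemma exp_f_f:
  assumes "i \<noteq> j" "A i j = -1"
  shows "ad_nilp (c \<odot> f i) (f j)" "exp_ad L (c \<odot> f i) (f j) = f j \<oplus> c \<odot> br (f i) (f j)"
  using exp_ad_linear[of "c \<odot> f i" "f j"] br_f_f_f_eq_zero[OF assms]
  by (simp_all add: br_smult_left br_smult_right)

lemma exp_f_fixed:
  assumes "y \<in> carrier L" "br (f i) y = \<zero>"
  shows "ad_nilp (c \<odot> f i) y" "exp_ad L (c \<odot> f i) y = y"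
  using exp_ad_fixed[of "c \<odot> f i" y] assms by (simp_all add: br_smult_left)

text \<open>By \<open>exp_f_e\<close> with \<open>- c\<close> for \<open>c\<close>, the element is
  the image of \<open>e i\<close> under the exponential of \<open>(- c) \<odot> f i\<close>, which
  the opposite exponential undoes. The proof compares coefficients directly.\<close>

lemma exp_f_u:
  "ad_nilp (c \<odot> f i) (e i \<oplus> c \<odot> h i \<oplus> (- c\<^sup>2) \<odot> f i)"
  "exp_ad L (c \<odot> f i) (e i \<oplus> c \<odot> h i \<oplus> (- c\<^sup>2) \<odot> f i) = e i"
proof -
  show "ad_nilp (c \<odot> f i) (e i \<oplus> c \<odot> h i \<oplus> (- c\<^sup>2) \<odot> f i)"
    by (intro ad_nilp_add ad_nilp_scale exp_f_e exp_f_h exp_f_fixed) auto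
  have "exp_ad L (c \<odot> f i) (e i \<oplus> c \<odot> h i \<oplus> (- c\<^sup>2) \<odot> f i)
     = (e i \<oplus> (- c) \<odot> h i \<oplus> (- c\<^sup>2) \<odot> f i) \<oplus> c \<odot> (h i \<oplus> (c * 2) \<odot> f i) \<oplus> (- c\<^sup>2) \<odot> f i"
    by (simp add: exp_ad_add exp_ad_scale ad_nilp_add ad_nilp_scale exp_f_e exp_f_h exp_f_fixed diag)
  also have "\<dots> = e i \<oplus> (- c + c) \<odot> h i \<oplus> (- c\<^sup>2 + (c * (c * 2)) + - c\<^sup>2) \<odot> f i"
    by (simp only: scale_add_left scale_add_right scale_scale a_ac a_closed scale_closed e_closed f_closed br_closed)
  also have "\<dots> = e i"
    by (simp add: power2_eq_square)
  finally show "exp_ad L (c \<odot> f i) (e i \<oplus> c \<odot> h i \<oplus> (- c\<^sup>2) \<odot> f i) = e i" .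
qed

text \<open>\<open>f j\<close> commutes with \<open>e i\<close>, and the other two series are
  linear: \<open>A i j = -1\<close> gives the coefficient of \<open>f j\<close>, and
  \<open>A j i = -1\<close> makes \<open>[f j, [f j, f i]]\<close> vanish.\<close>

lemma exp_f_u_neighbour:
  assumes "i \<noteq> j" "A i j = -1" "A j i = -1"
  shows "exp_ad L (d \<odot> f j) (e i \<oplus> c \<odot> h i \<oplus> (- c\<^sup>2) \<odot> f i)
    = (e i \<oplus> c \<odot> h i \<oplus> (- c\<^sup>2) \<odot> f i) \<oplus> (- d * c) \<odot> f j \<oplus> (- d * c\<^sup>2) \<odot> br (f j) (f i)"
proof -
  have "exp_ad L (d \<odot> f j) (e i \<oplus> c \<odot> h i \<oplus> (- c\<^sup>2) \<odot> f i)
     = e i \<oplus> c \<odot> (h i \<oplus> (- d) \<odot> f j) \<oplus> (- c\<^sup>2) \<odot> (f i \<oplus> d \<odot> br (f j) (f i))"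
    using assms
    by (simp add: exp_ad_add exp_ad_scale ad_nilp_add ad_nilp_scale exp_f_fixed br_f_e exp_f_h exp_f_f)
  also have "\<dots> = (e i \<oplus> c \<odot> h i \<oplus> (- c\<^sup>2) \<odot> f i) \<oplus> (- d * c) \<odot> f j \<oplus> (- d * c\<^sup>2) \<odot> br (f j) (f i)"
    by (simp add: scale_add_right scale_scale a_ac mult_ac)
  finally show ?thesis .
qed

text \<open>The factor of \<open>i\<close> takes the \<open>u\<close> part back to
  \<open>e i\<close>, and from \<open>f j\<close> it creates a multiple of \<open>[f i, f j]\<close>
  that cancels the multiple of \<open>[f j, f i]\<close> already present.\<close>

lemma exp_f_exp_f_u:
  assumes "i \<noteq> j" "A i j = -1" "A j i = -1"
  shows "exp_ad L (c \<odot> f i) (exp_ad L (d \<odot> f j) (e i \<oplus> c \<odot> h i \<oplus> (- c\<^sup>2) \<odot> f i))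
    = e i \<oplus> (- d * c) \<odot> f j"
proof -
  have g: "br (f j) (f i) = (-1) \<odot> br (f i) (f j)"
    by (rule br_skew) auto
  have z: "br (f i) (br (f j) (f i)) = \<zero>"
    unfolding g using br_f_f_f_eq_zero[OF assms(1,2)] by (simp add: br_smult_right)
  define U where "U = e i \<oplus> c \<odot> h i \<oplus> (- c\<^sup>2) \<odot> f i"
  have U: "U \<in> carrier L" "ad_nilp (c \<odot> f i) U" "exp_ad L (c \<odot> f i) U = e i"
    using exp_f_u by (simp_all add: U_def)
  have "exp_ad L (c \<odot> f i) (exp_ad L (d \<odot> f j) U)
     = e i \<oplus> (- d * c) \<odot> (f j \<oplus> c \<odot> br (f i) (f j)) \<oplus> (- d * c\<^sup>2) \<odot> br (f j) (f i)"
    unfolding U_def exp_f_u_neighbour[OF assms] unfolding U_def[symmetric]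
    using U assms exp_f_fixed[OF _ z]
    by (simp add: exp_ad_add exp_ad_scale ad_nilp_add ad_nilp_scale exp_f_f)
  also have "\<dots> = e i \<oplus> (- d * c) \<odot> f j \<oplus> ((- d * c) * c + (- d * c\<^sup>2) * (-1)) \<odot> br (f i) (f j)"
    unfolding g
    by (simp only: scale_add_left scale_add_right scale_scale a_ac a_closed scale_closed e_closed f_closed br_closed)
  also have "\<dots> = e i \<oplus> (- d * c) \<odot> f j"
    by (simp add: power2_eq_square)
  finally show ?thesis
    unfolding U_def .
qed

end

section \<open>The action along a conical tree\<close>

lemma gamma_edge_irreflp: "irreflp (gamma_edge A)"
  by (simp add: irreflp_def gamma_edge_def)

lemma gamma_edge_symp: "gen_cartan_matrix A \<Longrightarrow> symp (gamma_edge A)"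
  unfolding gen_cartan_matrix_def gamma_edge_def symp_def by (metis order_le_less)

locale conical_chevalley = chevalley_relations L A e f
  for L :: "('a, 'm) lie_alg_scheme" (structure)
    and A :: "'i::finite \<Rightarrow> 'i \<Rightarrow> int" and e f :: "'i \<Rightarrow> 'a" +
  fixes r :: 'i and a :: "'i \<Rightarrow> complex" and js :: "'i list"
  assumes gcm: "gen_cartan_matrix A"
    and conical: "conical_tree (gamma_edge A) r"
    and simple: "\<And>i j. i \<noteq> j \<Longrightarrow> j \<noteq> r \<Longrightarrow> A i j \<in> {0, -1}"
    and decreasing: "decreasing_enum (gamma_edge A) r js"
begin

abbreviation "G \<equiv> gamma_edge A"
abbreviation "ch i \<equiv> children G r i"
abbreviation F :: "'i \<Rightarrow> 'a" where "F i \<equiv> a i \<odot> f i"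
abbreviation u :: "'i \<Rightarrow> 'a" where "u i \<equiv> e i \<oplus> a i \<odot> h i \<oplus> (- (a i)\<^sup>2) \<odot> f i"

section \<open>Neighbours in the tree and the order of the factors\<close>

lemma tree: "graph_tree G"
  using conical unfolding conical_tree_def by blast

lemma edge_cases: "G k l \<Longrightarrow> k \<in> ch l \<or> l \<in> ch k"
  using edge_imp_child[OF gamma_edge_symp[OF gcm] gamma_edge_irreflp tree] .

lemma not_edge:
  assumes "k \<noteq> l" "k \<notin> ch l" "l \<notin> ch k"
  shows "A k l = 0" "A l k = 0"
proof -
  have "A k l = 0"
    using assms edge_cases[of k l] gcm unfolding gamma_edge_def gen_cartan_matrix_def
    by (metis order_le_less)
  then show "A k l = 0" "A l k = 0"
    using gcm unfolding gen_cartan_matrix_def by auto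
qed

lemma child_not_root: "j \<in> ch i \<Longrightarrow> j \<noteq> r"
  by (simp add: children_def)

lemma child_unique: "j \<in> ch i \<Longrightarrow> j \<in> ch k \<Longrightarrow> i = k"
  by (simp add: children_def)

lemma child_edge: "j \<in> ch i \<Longrightarrow> G j i"
  using parent_edge[OF gamma_edge_symp[OF gcm] tree, of j r] by (auto simp: children_def)

lemma child_neq: "j \<in> ch i \<Longrightarrow> i \<noteq> j"
  using child_edge[of j i] by (auto simp: gamma_edge_def)

text \<open>Entries along an edge are negative, so \<open>simple\<close> makes them -1 outside the
  root column. The child's column is never that one, but the parent's may be.\<close>

lemma A_child:
  assumes "j \<in> ch i"
  shows "A i j = -1" "i \<noteq> r \<Longrightarrow> A j i = -1"
proof -
  have "G j i" "G i j"
    using child_edge[OF assms] gamma_edge_symp[OF gcm] by (auto dest: sympD)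
  then show "A i j = -1" "i \<noteq> r \<Longrightarrow> A j i = -1"
    using simple[of i j] simple[of j i] child_not_root[OF assms]
    unfolding gamma_edge_def by fastforce+
qed

lemma js: "distinct js" "set js = UNIV - {r}"
  using decreasing unfolding decreasing_enum_def by auto

lemma parent_before:
  assumes "js = xs @ k # ys" "k \<in> ch l" "l \<noteq> r"
  shows "l \<in> set xs"
proof -
  have "l \<in> set js"
    using js assms by simp
  then obtain m where m: "m < length js" "js ! m = l"
    by (auto simp: in_set_conv_nth)
  have "length xs < length js" "js ! length xs = k"
    by (simp_all add: assms)
  moreover have "parent G r k = l"
    using assms(2) by (simp add: children_def)
  ultimately have "m < length xs"
    using decreasing m unfolding decreasing_enum_def by metis
  then show ?thesis
    using m(2) by (metis assms(1) nth_append nth_mem)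
qed

text \<open>A child to the left of \<open>k\<close> would, by \<open>parent_before\<close>, have
  \<open>k\<close> still further left, and \<open>k\<close> would occur twice.\<close>

lemma child_not_before:
  assumes "js = xs @ k # ys" "l \<in> ch k"
  shows "l \<notin> set xs"
proof
  assume "l \<in> set xs"
  then obtain us vs where xs: "xs = us @ l # vs"
    by (meson split_list)
  have "k \<noteq> r"
    using assms js by auto
  then have "k \<in> set us"
    using parent_before[of us l "vs @ k # ys" k] assms xs by simp
  then show False
    using js(1) assms(1) xs by simp
qed

lemma br_F_e: "k \<noteq> i \<Longrightarrow> br (F k) (e i) = \<zero>"
  by (simp add: br_smult_left br_f_e)

lemma br_F_f: "k \<noteq> i \<Longrightarrow> k \<notin> ch i \<Longrightarrow> i \<notin> ch k \<Longrightarrow> br (F k) (f i) = \<zero>"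
  by (simp add: br_smult_left br_f_f_eq_zero not_edge)

lemma br_F_u:
  assumes "k \<noteq> i" "k \<notin> ch i" "i \<notin> ch k"
  shows "br (F k) (u i) = \<zero>"
  using assms
  by (simp add: br_add_right br_F_e br_F_f br_smult_right) (simp add: br_smult_left br_f_h not_edge)

lemma Ad_nonroot:
  assumes i: "i \<noteq> r"
  shows "Ad_prod L (map F (r # js)) (u i)
    = e i \<oplus> (if ch i = {} then \<zero> else (- a (only_child G r i) * a i) \<odot> f (only_child G r i))"
proof (cases "ch i = {}")
  case True
  obtain p q where s: "js = p @ i # q"
    using i js(2) by (metis DiffI UNIV_I singletonD split_list)
  have q: "br (F k) (u i) = \<zero>" if "k \<in> set q" for k
  proof (rule br_F_u)
    show "k \<noteq> i"
      using that js(1) s by auto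
    show "i \<notin> ch k"
      using parent_before[OF s, of k] that js s by auto
    show "k \<notin> ch i"
      using True by simp
  qed
  \<comment> \<open>The parent of \<open>i\<close> is among these factors, but by now only
    \<open>e i\<close> is left, which commutes with every other \<open>f k\<close>.\<close>
  have p: "br (F k) (e i) = \<zero>" if "k \<in> set (r # p)" for k
    using that i js(1) s by (intro br_F_e) auto
  have "Ad_prod L (map F (r # js)) (u i)
      = Ad_prod L (map F (r # p)) (exp_ad L (F i) (Ad_prod L (map F q) (u i)))"
    by (simp add: s Ad_prod_append Ad_prod_Cons)
  also have "Ad_prod L (map F q) (u i) = u i"
    by (rule Ad_prod_fixed) (auto simp: q)
  also have "exp_ad L (F i) (u i) = e i"
    by (rule exp_f_u)
  also have "Ad_prod L (map F (r # p)) (e i) = e i"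
    using p by (intro Ad_prod_fixed) auto
  finally show ?thesis
    using True by simp
next
  case False
  have "card (ch i) \<le> 1"
    using conical i unfolding conical_tree_def by blast
  then obtain j where j: "ch i = {j}"
    using False card_le_Suc0_iff_eq[of "ch i"] by auto
  have oc: "only_child G r i = j"
    unfolding only_child_def j by simp
  have "j \<in> set js"
    using js child_not_root[of j i] j by simp
  then obtain p' q' where s': "js = p' @ j # q'"
    by (meson split_list)
  then have "i \<in> set p'"
    using parent_before[OF s', of i] j i by simp
  then obtain p q where p': "p' = p @ i # q"
    by (meson split_list)
  \<comment> \<open>The factors act in the order \<open>q'\<close>, \<open>j\<close>,
    \<open>q\<close>, \<open>i\<close>, \<open>p\<close>, root.\<close>
  have s: "js = p @ i # (q @ j # q')" "js = (p @ i # q) @ j # q'"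
    using s' p' by simp_all
  have d: "distinct (p @ i # (q @ j # q'))" "r \<notin> set (p @ i # (q @ j # q'))"
    using js unfolding s(1) by auto
  have ij: "i \<noteq> j" "A i j = -1" "A j i = -1"
    using child_neq A_child j i by auto
  \<comment> \<open>The only child of \<open>i\<close> is \<open>j\<close>, and the parent of
    \<open>i\<close> stands to its left, so these blocks contain no neighbour of
    \<open>i\<close>.\<close>
  have qi: "k \<noteq> i \<and> k \<notin> ch i \<and> i \<notin> ch k" if "k \<in> set q \<union> set q'" for k
  proof -
    have "k \<notin> ch i"
      using that d j by auto
    moreover have "i \<notin> ch k"
      using parent_before[OF s(1), of k] that d by auto
    ultimately show ?thesis
      using that d by auto
  qed
  \<comment> \<open>Children of \<open>j\<close> come after \<open>j\<close>, and its parent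
    \<open>i\<close> lies outside these blocks. In particular the factor of the parent of
    \<open>i\<close> does not move \<open>f j\<close>.\<close>
  have pj: "k \<noteq> j \<and> k \<notin> ch j \<and> j \<notin> ch k" if "k \<in> set q \<union> set (r # p)" for k
  proof -
    have "k \<notin> ch j"
      using child_not_before[OF s(2), of k] that child_not_root[of k j] by auto
    moreover have "j \<notin> ch k"
      using child_unique[of j i k] that d j i by auto
    ultimately show ?thesis
      using that d by auto
  qed
  let ?w = "exp_ad L (F j) (u i)"
  have w: "?w = u i \<oplus> (- a j * a i) \<odot> f j \<oplus> (- a j * (a i)\<^sup>2) \<odot> br (f j) (f i)"
    by (rule exp_f_u_neighbour[OF ij])
  have bw: "br (F k) ?w = \<zero>" if "k \<in> set q" for k
  proof -
    have 1: "br (F k) (f j) = \<zero>" "br (F k) (f i) = \<zero>" "br (F k) (u i) = \<zero>"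
      using that qi[of k] pj[of k] by (auto intro!: br_F_f br_F_u simp del: Un_iff)
    then show ?thesis
      unfolding w by (simp add: br_add_right[of "F k" "u i \<oplus> _"] br_add_right[of "F k" "u i"] br_smult_right
        br_leibniz[of "F k" "f j" "f i"] del: a_assoc)
  qed
  have "Ad_prod L (map F (r # js)) (u i)
      = Ad_prod L (map F (r # p)) (exp_ad L (F i) (Ad_prod L (map F q) (exp_ad L (F j)
          (Ad_prod L (map F q') (u i)))))"
    by (simp add: s(1) Ad_prod_append Ad_prod_Cons)
  also have "Ad_prod L (map F q') (u i) = u i"
    using qi by (intro Ad_prod_fixed) (auto intro!: br_F_u)
  also have "Ad_prod L (map F q) ?w = ?w"
    using bw by (intro Ad_prod_fixed) (auto simp: w)
  also have "exp_ad L (F i) ?w = e i \<oplus> (- a j * a i) \<odot> f j"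
    by (rule exp_f_exp_f_u[OF ij])
  also have "Ad_prod L (map F (r # p)) (e i \<oplus> (- a j * a i) \<odot> f j) = e i \<oplus> (- a j * a i) \<odot> f j"
  proof (rule Ad_prod_fixed)
    fix x assume "x \<in> set (map F (r # p))"
    then obtain k where k: "k \<in> set (r # p)" "x = F k"
      by auto
    then have "k \<noteq> i"
      using d i by auto
    then show "x \<in> carrier L \<and> br x (e i \<oplus> (- a j * a i) \<odot> f j) = \<zero>"
      using k(1) pj[of k] unfolding k(2)
      by (simp add: br_add_right br_smult_right br_F_e br_F_f del: set_simps)
  qed simp
  finally show ?thesis
    using j by (simp add: oc)
qed

text \<open>The last factor acts first, so the induction runs over suffixes; \<open>ps\<close> keeps
  the rest of the list at hand for the order condition. \<open>S\<close> collects the children of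
  the root met so far.\<close>

lemma Ad_root_suffix:
  assumes "js = ps @ ks"
  defines "S \<equiv> \<Oplus>j\<in>set ks \<inter> ch r. F j"
  shows "ad_nilp S (f r) \<and> Ad_prod L (map F ks) (u r)
    = e r \<oplus> a r \<odot> h r \<oplus> (- a r) \<odot> S \<oplus> (- (a r)\<^sup>2) \<odot> exp_ad L S (f r)"
  using assms(1) unfolding S_def
proof (induction ks arbitrary: ps)
  case Nil
  then show ?case
    using exp_ad_fixed[of \<zero> "f r"] by (simp add: Ad_prod_def)
next
  case (Cons k ks)
  define S where "S = (\<Oplus>j\<in>set ks \<inter> ch r. F j)"
  have S [simp]: "S \<in> carrier L"
    unfolding S_def by (rule finsum_closed) auto
  have IH: "ad_nilp S (f r)" "Ad_prod L (map F ks) (u r)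
    = e r \<oplus> a r \<odot> h r \<oplus> (- a r) \<odot> S \<oplus> (- (a r)\<^sup>2) \<odot> exp_ad L S (f r)"
    using Cons.IH[of "ps @ [k]"] Cons.prems by (simp_all add: S_def)
  have ex [simp]: "exp_ad L S (f r) \<in> carrier L"
    by (rule exp_ad_closed) (simp_all add: IH)
  have k: "k \<notin> set ks" "k \<noteq> r"
    using js Cons.prems by auto
  \<comment> \<open>The parent of \<open>j\<close> is the root and the parent of \<open>k\<close>
    cannot come later in \<open>js\<close>, so \<open>j\<close> and \<open>k\<close> are not
    adjacent.\<close>
  have "br (F k) (F j) = \<zero>" if "j \<in> set ks \<inter> ch r" for j
  proof -
    have "k \<notin> ch j"
      using parent_before[OF Cons.prems, of j] that js Cons.prems by auto
    moreover have "j \<notin> ch k"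
      using that k child_unique[of j r k] by auto
    moreover have "k \<noteq> j"
      using k that by auto
    ultimately show ?thesis
      using br_F_f[of k j] by (simp add: br_smult_right)
  qed
  then have kS: "br (F k) S = \<zero>"
    unfolding S_def by (subst br_finsum) (auto intro!: add.finprod_one_eqI)
  have step: "Ad_prod L (map F (k # ks)) (u r)
    = exp_ad L (F k) (e r \<oplus> a r \<odot> h r \<oplus> (- a r) \<odot> S \<oplus> (- (a r)\<^sup>2) \<odot> exp_ad L S (f r))"
    by (simp add: Ad_prod_Cons IH)
  show ?case
  proof (cases "k \<in> ch r")
    case True
    have S': "(\<Oplus>j\<in>set (k # ks) \<inter> ch r. F j) = F k \<oplus> S"
      unfolding S_def using True k by (simp add: Pi_def)
    have nk: "ad_nilp (F k) (f r)"
      using k ad_nilp_f by blast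
    note c = exp_ad_commuting[of "F k" S "f r", OF _ _ _ kS nk IH(1)]
    \<comment> \<open>The coefficient is \<open>A r k = -1\<close>, and it adds \<open>F k\<close>
      to the linear term in \<open>S\<close>; by \<open>c\<close>, the exponent gains the same
      summand.\<close>
    have "exp_ad L (F k) (h r) = h r \<oplus> (- 1) \<odot> F k"
      using exp_f_h(2)[of "a k" k r] A_child(1)[OF True] by (simp add: scale_scale)
    moreover have "exp_ad L (F k) (e r) = e r" "ad_nilp (F k) (e r)"
      using exp_ad_fixed[of "F k" "e r"] k by (simp_all add: br_F_e)
    moreover have "exp_ad L (F k) S = S" "ad_nilp (F k) S"
      using exp_ad_fixed[of "F k" S] kS by simp_all
    ultimately have "Ad_prod L (map F (k # ks)) (u r)
      = e r \<oplus> a r \<odot> (h r \<oplus> (- 1) \<odot> F k) \<oplus> (- a r) \<odot> S \<oplus> (- (a r)\<^sup>2) \<odot> exp_ad L (F k \<oplus> S) (f r)"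
      unfolding step
      by (simp add: exp_ad_add exp_ad_scale ad_nilp_add ad_nilp_scale exp_f_h c)
    also have "\<dots> = e r \<oplus> a r \<odot> h r \<oplus> (- a r) \<odot> (F k \<oplus> S) \<oplus> (- (a r)\<^sup>2) \<odot> exp_ad L (F k \<oplus> S) (f r)"
      using exp_ad_closed[of "F k \<oplus> S" "f r"] c(1)
      by (simp add: scale_add_right scale_scale a_ac)
    finally show ?thesis
      unfolding S' using c(1) by simp
  next
    case False
    have S': "(\<Oplus>j\<in>set (k # ks) \<inter> ch r. F j) = S"
      unfolding S_def using False by simp
    have nr: "r \<notin> ch k"
      by (simp add: children_def)
    \<comment> \<open>Here \<open>k\<close> is not adjacent to the root, so its factor fixes every
      summand.\<close>
    have "br (F k) (exp_ad L S (f r)) = \<zero>"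
      using br_exp_ad_eq_zero[of "F k" S "f r"] kS IH(1) br_F_f[of k r] k False nr by simp
    moreover have "br (F k) (e r) = \<zero>"
      using k by (intro br_F_e)
    moreover have "br (F k) (h r) = \<zero>"
      using not_edge[of k r] k False nr by (simp add: br_smult_left br_f_h)
    ultimately have "br (F k) (e r \<oplus> a r \<odot> h r \<oplus> (- a r) \<odot> S \<oplus> (- (a r)\<^sup>2) \<odot> exp_ad L S (f r)) = \<zero>"
      using kS by (simp add: br_add_right br_smult_right)
    then show ?thesis
      unfolding S' step using exp_ad_fixed(2)[of "F k"] IH(1) by simp
  qed
qed

lemma Ad_root:
  defines "ff \<equiv> \<Oplus>j\<in>ch r. F j"
  defines "ffr \<equiv> br ff (br ff (f r))"
  shows "Ad_prod L (map F (r # js)) (u r)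
    = e r \<ominus> a r \<odot> ff \<ominus> ((a r)\<^sup>2 / 2) \<odot> ffr
      \<ominus> supp_sum L (\<lambda>k. ((a r)\<^sup>2 / fact k) \<odot> (br (ff \<oplus> a r \<odot> br (f r) ff) ^^ (k - 2)) ffr) {3..}"
proof -
  define w where "w = br (f r) ff"
  define g where "g = ff \<oplus> a r \<odot> w"
  have ff [simp]: "ff \<in> carrier L"
    unfolding ff_def by (rule finsum_closed) auto
  have w [simp]: "w \<in> carrier L" and g [simp]: "g \<in> carrier L" and ffr [simp]: "ffr \<in> carrier L"
    by (simp_all add: w_def g_def ffr_def)
  have "set js \<inter> ch r = ch r"
    using js child_not_root by auto
  then have nil: "ad_nilp ff (f r)" and suffix: "Ad_prod L (map F js) (u r)
    = e r \<oplus> a r \<odot> h r \<oplus> (- a r) \<odot> ff \<oplus> (- (a r)\<^sup>2) \<odot> exp_ad L ff (f r)"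
    using Ad_root_suffix[of "[]" js] by (simp_all add: ff_def)
  \<comment> \<open>For each child \<open>j\<close> the entry \<open>A r j\<close> is -1, so
    \<open>[f r, [f r, f j]] = 0\<close> by the Serre relation.\<close>
  have rw: "br (f r) w = \<zero>"
    unfolding w_def ff_def
    by (subst br_finsum, simp, simp, subst br_finsum)
       (auto intro!: add.finprod_one_eqI simp: br_smult_right br_f_f_f_eq_zero child_neq A_child)
  have xff: "br (F r) ff = a r \<odot> w"
    by (simp add: w_def br_smult_left)
  have xxff: "br (F r) (br (F r) ff) = \<zero>"
    unfolding xff by (simp add: br_smult_left br_smult_right rw)
  have e1: "exp_ad L (F r) ff = g" "ad_nilp (F r) ff"
    using exp_ad_linear[of "F r" ff] xxff xff by (simp_all add: g_def)
  have fr: "br (F r) (f r) = \<zero>"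
    by (simp add: br_smult_left)
  have e2: "ad_nilp (F r) (exp_ad L ff (f r))" "ad_nilp g (f r)"
      "exp_ad L (F r) (exp_ad L ff (f r)) = exp_ad L g (f r)"
    using exp_ad_exp_ad[of "F r" ff "f r"] xxff fr nil unfolding xff g_def[symmetric] by simp_all
  obtain n0 where n0: "(br g ^^ n0) (f r) = \<zero>"
    using e2(2) unfolding ad_nilp_def by blast
  \<comment> \<open>Adding 3 puts the indices 0, 1 and 2 below \<open>n\<close>, so that they can be
    split off.\<close>
  define n where "n = n0 + 3"
  have n: "(br g ^^ n) (f r) = \<zero>"
    using ad_pow_mono[OF g n0] by (simp add: n_def)
  have ffr': "br ff (f r) = (-1) \<odot> w"
    unfolding w_def by (rule br_skew) auto
  \<comment> \<open>The summand of \<open>g\<close> with \<open>w\<close> drops out here because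
    \<open>[w, f r] = 0\<close>, and in the next step because \<open>[w, w] = 0\<close>.\<close>
  have g1: "br g (f r) = (-1) \<odot> w"
    using br_skew[of "f r" w] rw unfolding g_def by (simp add: br_add_left br_smult_left ffr')
  have g2: "br g ((-1) \<odot> w) = ffr"
    unfolding g_def ffr_def by (simp add: br_add_left br_smult_left br_smult_right br_self ffr')
  have gk: "(br g ^^ (k - 2)) ffr = (br g ^^ k) (f r)" if "k \<ge> 3" for k
  proof -
    have "(br g ^^ 2) (f r) = ffr"
      by (simp add: numeral_2_eq_2 g1 g2)
    moreover have "(br g ^^ (k - 2 + 2)) (f r) = (br g ^^ (k - 2)) ((br g ^^ 2) (f r))"
      by (simp only: funpow_add o_apply)
    moreover have "k - 2 + 2 = k"
      using that by simp
    ultimately show ?thesis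
      by metis
  qed
  define T where "T = (\<Oplus>k\<in>{3..<n}. (1 / fact k) \<odot> (br g ^^ k) (f r))"
  have T [simp]: "T \<in> carrier L"
    unfolding T_def by (rule finsum_closed) auto
  have "{..<n} = insert 0 (insert 1 (insert 2 {3..<n}))"
    by (auto simp: n_def)
  then have eg: "exp_ad L g (f r) = f r \<oplus> ((-1) \<odot> w \<oplus> ((1 / 2) \<odot> ffr \<oplus> T))"
    using exp_ad_eq[OF g _ n] by (simp add: T_def Pi_def numeral_2_eq_2 g1 g2)
  \<comment> \<open>All terms from \<open>n\<close> on vanish, so \<open>supp_sum\<close> is a true
    finite sum and not a default value.\<close>
  have sT: "supp_sum L (\<lambda>k. ((a r)\<^sup>2 / fact k) \<odot> (br g ^^ (k - 2)) ffr) {3..} = (a r)\<^sup>2 \<odot> T"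
  proof -
    have z: "((a r)\<^sup>2 / fact k) \<odot> (br g ^^ (k - 2)) ffr = \<zero>" if "k \<in> {3..} - {3..<n}" for k
    proof -
      have "3 \<le> k" "n \<le> k"
        using that by auto
      then have "(br g ^^ (k - 2)) ffr = \<zero>"
        using gk[of k] ad_pow_mono[OF g n, of k] by simp
      then show ?thesis
        by (simp only: scale_zero)
    qed
    have "supp_sum L (\<lambda>k. ((a r)\<^sup>2 / fact k) \<odot> (br g ^^ (k - 2)) ffr) {3..}
       = (\<Oplus>k\<in>{3..<n}. ((a r)\<^sup>2 / fact k) \<odot> (br g ^^ (k - 2)) ffr)"
      using z by (intro supp_sum_eq) auto
    also have "\<dots> = (\<Oplus>k\<in>{3..<n}. (a r)\<^sup>2 \<odot> ((1 / fact k) \<odot> (br g ^^ k) (f r)))"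
      by (intro finsum_cong') (auto simp: gk scale_scale)
    also have "\<dots> = (a r)\<^sup>2 \<odot> T"
      unfolding T_def by (intro scale_finsum[symmetric]) auto
    finally show ?thesis .
  qed
  have "Ad_prod L (map F (r # js)) (u r)
     = (e r \<oplus> (- a r) \<odot> h r \<oplus> (- (a r)\<^sup>2) \<odot> f r) \<oplus> a r \<odot> (h r \<oplus> (a r * 2) \<odot> f r)
       \<oplus> (- a r) \<odot> (ff \<oplus> a r \<odot> w) \<oplus> (- (a r)\<^sup>2) \<odot> (f r \<oplus> ((-1) \<odot> w \<oplus> ((1 / 2) \<odot> ffr \<oplus> T)))"
    using exp_ad_closed[of ff "f r"] nil
    by (simp add: Ad_prod_Cons suffix exp_ad_add exp_ad_scale ad_nilp_add ad_nilp_scale exp_f_e exp_f_h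
        e1 e2 diag eg flip: g_def)
  \<comment> \<open>The coefficients of \<open>h r\<close>, \<open>f r\<close> and \<open>w\<close>
    are zero: orders 0 and 1 of the series cancel against terms from the images of
    \<open>e r\<close>, \<open>h r\<close> and \<open>ff\<close>.\<close>
  also have "\<dots> = e r \<oplus> (- a r + a r) \<odot> h r \<oplus> (- (a r)\<^sup>2 + (a r * (a r * 2)) + - (a r)\<^sup>2) \<odot> f r
       \<oplus> (- a r * a r + - (a r)\<^sup>2 * -1) \<odot> w
       \<oplus> (- a r) \<odot> ff \<oplus> (- (a r)\<^sup>2 * (1 / 2)) \<odot> ffr \<oplus> (- (a r)\<^sup>2) \<odot> T"
    by (simp only: scale_add_left scale_add_right scale_scale a_ac a_closed scale_closed
        e_closed f_closed br_closed ff w ffr T)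
  also have "\<dots> = e r \<oplus> (- a r) \<odot> ff \<oplus> (- (a r)\<^sup>2 / 2) \<odot> ffr \<oplus> (- (a r)\<^sup>2) \<odot> T"
    by (simp add: power2_eq_square)
  also have "\<dots> = e r \<ominus> a r \<odot> ff \<ominus> ((a r)\<^sup>2 / 2) \<odot> ffr \<ominus> (a r)\<^sup>2 \<odot> T"
    by (simp add: diff_eq_scale scale_scale)
  finally show ?thesis
    unfolding sT[symmetric] g_def w_def .
qed

end

section \<open>Specialisation to the Kac-Moody algebra\<close>

theorem theorem2p1:
  fixes A :: "'i::finite \<Rightarrow> 'i \<Rightarrow> int" and r :: 'i and a :: "'i \<Rightarrow> complex"
    and js :: "'i list" and i :: 'i
  assumes "gen_cartan_matrix A"
    and "conical_tree (gamma_edge A) r"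
    and "\<And>i j. i \<noteq> j \<Longrightarrow> j \<noteq> r \<Longrightarrow> A i j \<in> {0, -1}"
    and "decreasing_enum (gamma_edge A) r js"
  shows "Ad_g A r a js (u_elt A a i) =
    (let L = kac_moody A; e = km_e A; f = km_f A; ff = bold_f A r a;
         c = only_child (gamma_edge A) r i;
         ffr = br\<^bsub>L\<^esub> ff (br\<^bsub>L\<^esub> ff (f r))
     in
      if i \<noteq> r then
        e i \<oplus>\<^bsub>L\<^esub> (if children (gamma_edge A) r i = {} then \<zero>\<^bsub>L\<^esub> else (- a c * a i) \<odot>\<^bsub>L\<^esub> f c)
      else
        e r \<ominus>\<^bsub>L\<^esub> a r \<odot>\<^bsub>L\<^esub> ff
          \<ominus>\<^bsub>L\<^esub> ((a r)\<^sup>2 / 2) \<odot>\<^bsub>L\<^esub> ffr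
          \<ominus>\<^bsub>L\<^esub> supp_sum L
              (\<lambda>k. ((a r)\<^sup>2 / fact k) \<odot>\<^bsub>L\<^esub>
                ((br\<^bsub>L\<^esub> (ff \<oplus>\<^bsub>L\<^esub> a r \<odot>\<^bsub>L\<^esub> br\<^bsub>L\<^esub> (f r) ff) ^^ (k - 2)) ffr))
              {3..})"
proof -
  interpret complex_lie_algebra "kac_moody A"
    unfolding kac_moody_def by (rule lie_pres_complex_lie_algebra)
  interpret conical_chevalley "kac_moody A" A "km_e A" "km_f A" r a js
  proof
    show "km_e A i \<in> carrier (kac_moody A)" "km_f A i \<in> carrier (kac_moody A)" for i
      by (simp_all add: kac_moody_def km_e_def km_f_def lie_pres_simps)
    show "br\<^bsub>kac_moody A\<^esub> (km_e A i) (km_f A j) = \<zero>\<^bsub>kac_moody A\<^esub>" if "i \<noteq> j" for i j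
      using cartan_rel.intros(2)[of A i j] that
      by (simp add: kac_moody_def km_e_def km_f_def lie_pres_simps lie_class_eq_iff lie_cong.rel)
    show "br\<^bsub>kac_moody A\<^esub> (br\<^bsub>kac_moody A\<^esub> (km_e A i) (km_f A i)) (km_f A j)
        = (- of_int (A i j)) \<odot>\<^bsub>kac_moody A\<^esub> km_f A j" for i j
      using cartan_rel.intros(4)[of A i j]
      by (simp add: kac_moody_def km_e_def km_f_def lie_pres_simps lie_class_eq_iff lie_cong.rel)
    \<comment> \<open>Iterated brackets can be computed on representatives, which carries the Serre
      relation over from terms to classes.\<close>
    have pow: "(br\<^bsub>kac_moody A\<^esub> (km_f A i) ^^ n) (km_f A j)
        = lie_class (cartan_rel A) ((LBr (F_term i) ^^ n) (F_term j))" for i j n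
      by (induction n) (simp_all add: kac_moody_def km_f_def lie_pres_simps)
    show "(br\<^bsub>kac_moody A\<^esub> (km_f A i) ^^ nat (1 - A i j)) (km_f A j) = \<zero>\<^bsub>kac_moody A\<^esub>"
      if "i \<noteq> j" for i j
      unfolding pow using cartan_rel.intros(6)[OF that, of A]
      by (simp add: kac_moody_def lie_pres_simps lie_class_eq_iff lie_cong.rel)
    show "A i i = 2" for i
      using assms(1) by (simp add: gen_cartan_matrix_def)
  qed (fact assms)+
  \<comment> \<open>The subtraction in \<open>u_elt\<close> becomes the negative scalar in
    \<open>u\<close>.\<close>
  have u: "u_elt A a i = u i"
    unfolding u_elt_def by (simp add: diff_eq_scale scale_scale)
  show ?thesis
    using Ad_nonroot[of i] Ad_root
    unfolding Ad_g_def u bold_f_def Let_def by simp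
qed

end
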